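(* Consider the time-varying semidefinite program (TV-SDP) $$\sup_{x\in \mathbf{L}^n}\ \int_0^1\langle c(t),x(t)\rangle\,dt\quad\text{subject to}\quad Fx(t)\succeq 0\ \text{ for almost every } t\in[0,1],$$ with polynomial data $c, A_0,\dots,A_n,D_1,\dots,D_n$. Let $d\in\mathbb{N}$ and $$d'=\max\Big\{\deg(A_0),\ \max_{1\le i\le n}\deg(A_i)+d,\ \max_{1\le i\le n}\deg(D_i)+d+1\Big\}.$$ Then the semidefinite program $$\max_{x,Q_1,Q_2}\ \int_0^1\langle c(t),x(t)\rangle\,dt\quad\text{s.t.}\quad x\in\mathbb{R}^n_d[t],\quad Q_1\succeq0,\ Q_2\succeq0,\quad Fx=\alpha_{d'}^m(Q_1)+\beta_{d'}^m(Q_2)$$ (where $Q_1,Q_2$ are constant symmetric matrices of the appropriate sizes) finds the best polynomial solution of degree $d$ to the TV-SDP. That is, $x\in\mathbb{R}^n_d[t]$ is a feasible solution of the TV-SDP if and only if there exist positive semidefinite $Q_1,Q_2$ such that $Fx=\alpha_{d'}^m(Q_1)+\beta_{d'}^m(Q_2)$; consequently the optimal value of this semidefinite program equals the supremum of $\int_0^1\langle c(t),x(t)\rangle\,dt$ over all feasible solutions $x\in\mathbb{R}^n_d[t]$ of the TV-SDP.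
   Context: $\mathbf{L}^n$ is the set of measurable functions $x:[0,1]\to\mathbb{R}^n$ with $\sup_{t,i}|x_i(t)|<\infty$. $\mathbb{R}^n_d[t]$ is the set of vectors of $n$ real polynomials in $t$ of degree at most $d$. The data are: $c$, a vector of $n$ univariate real polynomials; $A_0,\dots,A_n$, symmetric $m\times m$ matrices whose entries are real polynomials in $t$; $D_1,\dots,D_n$, symmetric $m\times m$ matrices whose entries are real polynomials in $(t,s)$. The degree of a polynomial matrix is the maximum (total) degree of its entries; identically zero data are ignored in the maximum defining $d'$ (and $d'=0$ if all of the $A_i$ and $D_i$ vanish). For $x\in\mathbf{L}^n$, $$Fx(t)=A_0(t)+\sum_{i=1}^n x_i(t)A_i(t)+\sum_{i=1}^n\int_0^t x_i(s)D_i(t,s)\,ds.$$ A feasible solution of the TV-SDP is an $x\in\mathbf{L}^n$ with $Fx(t)\succeq0$ (positive semidefinite) for Lebesgue-almost every $t\in[0,1]$. Let $\mathcal{S}^N$ be the set of constant symmetric $N\times N$ real matrices. For an even integer $e\ge0$, index the rows and columns of $Q\in\mathcal{S}^{(e/2+1)m}$ by pairs $(i,k)$ with $1\le i\le m$, $0\le k\le e/2$ (the pair $(i,k)$ corresponds to the monomial $y_it^k$). Define the $m\times m$ polynomial matrix $\Lambda_e^m(Q)$ by $$\Lambda_e^m(Q)_{ij}(t)=\sum_{k,l=0}^{e/2}Q_{(i,k),(j,l)}\,t^{k+l},$$ equivalently, $\Lambda^m_e(Q)$ is the unique symmetric polynomial matrix $Y$ with $y^TY(t)y=v(t,y)^TQ\,v(t,y)$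 for all $t\in\mathbb{R}$, $y\in\mathbb{R}^m$, where $v(t,y)=(y_it^k)_{(i,k)}$. For an integer $e\ge 0$, define - if $e$ is odd: $\alpha_e^m(Q)=t\,\Lambda_{e-1}^m(Q)$ and $\beta_e^m(Q)=(1-t)\,\Lambda_{e-1}^m(Q)$, for $Q\in\mathcal{S}^{\frac{e+1}{2}m}$; - if $e$ is even: $\alpha_e^m(Q)=\Lambda_e^m(Q)$ for $Q\in\mathcal{S}^{(\frac e2+1)m}$, and $\beta_e^m(Q)=t(1-t)\Lambda_{e-2}^m(Q)$ for $Q\in\mathcal{S}^{\frac e2 m}$ (for $e=0$ the term $\beta_0^m$ is absent). *)

theory Defs
  imports "HOL-Analysis.Analysis" "HOL-Computational_Algebra.Polynomial"
begin

text \<open>A matrix whose rows and columns are indexed by a finite set \<open>I\<close> is a two-argument function;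
  its values outside \<open>I\<close> are irrelevant. This is needed because the size of the Gram matrices
  below depends on degrees and hence cannot be a type.\<close>

definition psd_on :: "'i set \<Rightarrow> ('i \<Rightarrow> 'i \<Rightarrow> real) \<Rightarrow> bool" where
  "psd_on I M \<longleftrightarrow> (\<forall>a\<in>I. \<forall>b\<in>I. M a b = M b a) \<and>
     (\<forall>v. 0 \<le> (\<Sum>a\<in>I. \<Sum>b\<in>I. v a * M a b * v b))"

definition psd :: "real ^ 'm ^ 'm \<Rightarrow> bool" where
  "psd M \<longleftrightarrow> psd_on UNIV (\<lambda>i j. M $ i $ j)"

definition pvec_eval :: "real poly ^ 'n \<Rightarrow> real \<Rightarrow> real ^ 'n" where
  "pvec_eval p t = (\<chi> i. poly (p $ i) t)"

definition pmat_eval :: "real poly ^ 'n ^ 'm \<Rightarrow> real \<Rightarrow> real ^ 'n ^ 'm" where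
  "pmat_eval M t = (\<chi> i j. poly (M $ i $ j) t)"

text \<open>A bivariate polynomial in \<open>(t, s)\<close> is a polynomial in \<open>s\<close> (outer variable) whose
  coefficients are polynomials in \<open>t\<close> (inner variable).\<close>

definition poly2 :: "real poly poly \<Rightarrow> real \<Rightarrow> real \<Rightarrow> real" where
  "poly2 p t s = poly (poly p [:s:]) t"

definition pmat_eval2 :: "real poly poly ^ 'n ^ 'm \<Rightarrow> real \<Rightarrow> real \<Rightarrow> real ^ 'n ^ 'm" where
  "pmat_eval2 M t s = (\<chi> i j. poly2 (M $ i $ j) t s)"

text \<open>Zero coefficients do not affect the maximum: they contribute \<open>k\<close>, which is at most the
  contribution of the leading coefficient. The total degree of \<open>0\<close> is \<open>0\<close>.\<close>

definition total_degree :: "real poly poly \<Rightarrow> nat" where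
  "total_degree p = Max ((\<lambda>k. k + degree (coeff p k)) ` {..degree p})"

definition pmat_degree :: "real poly ^ 'n ^ 'm \<Rightarrow> nat" where
  "pmat_degree M = Max {degree (M $ i $ j) | i j. True}"

definition pmat_total_degree :: "real poly poly ^ 'n ^ 'm \<Rightarrow> nat" where
  "pmat_total_degree M = Max {total_degree (M $ i $ j) | i j. True}"

definition poly_vecs :: "nat \<Rightarrow> (real poly ^ 'n) set" where
  "poly_vecs d = {p. \<forall>i. degree (p $ i) \<le> d}"

definition L_space :: "(real \<Rightarrow> real ^ 'n) set" where
  "L_space = {x. x \<in> borel_measurable (lebesgue_on {0..1}) \<and>
                 bdd_above {\<bar>x t $ i\<bar> | t i. t \<in> {0..1}}}"

definition F_op ::
  "real poly ^ 'm ^ 'm \<Rightarrow> ('n \<Rightarrow> real poly ^ 'm ^ 'm) \<Rightarrow> ('n \<Rightarrow> real poly poly ^ 'm ^ 'm)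
    \<Rightarrow> (real \<Rightarrow> real ^ 'n) \<Rightarrow> real \<Rightarrow> real ^ 'm ^ 'm" where
  "F_op A0 A D x t = pmat_eval A0 t + (\<Sum>i\<in>UNIV. (x t $ i) *\<^sub>R pmat_eval (A i) t)
     + (\<Sum>i\<in>UNIV. (LINT s:{0..t}|lebesgue. (x s $ i) *\<^sub>R pmat_eval2 (D i) t s))"

definition objective :: "real poly ^ 'n \<Rightarrow> (real \<Rightarrow> real ^ 'n) \<Rightarrow> real" where
  "objective c x = (LINT t:{0..1}|lebesgue. pvec_eval c t \<bullet> x t)"

definition tv_feasible ::
  "real poly ^ 'm ^ 'm \<Rightarrow> ('n \<Rightarrow> real poly ^ 'm ^ 'm) \<Rightarrow> ('n \<Rightarrow> real poly poly ^ 'm ^ 'm)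
    \<Rightarrow> (real \<Rightarrow> real ^ 'n) \<Rightarrow> bool" where
  "tv_feasible A0 A D x \<longleftrightarrow>
     x \<in> L_space \<and> (AE t in lebesgue_on {0..1}. psd (F_op A0 A D x t))"

text \<open>Row \<open>(i, k)\<close> of the Gram matrix \<open>Q\<close> corresponds to the monomial \<open>y\<^sub>i t\<^sup>k\<close>.
  Used for even \<open>e\<close> only.\<close>

definition Lambda :: "nat \<Rightarrow> ('m \<times> nat \<Rightarrow> 'm \<times> nat \<Rightarrow> real) \<Rightarrow> real poly ^ 'm ^ 'm" where
  "Lambda e Q = (\<chi> i j. \<Sum>k\<le>e div 2. \<Sum>l\<le>e div 2. monom (Q (i, k) (j, l)) (k + l))"

definition pmult :: "real poly \<Rightarrow> real poly ^ 'n ^ 'm \<Rightarrow> real poly ^ 'n ^ 'm" where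
  "pmult q M = (\<chi> i j. q * M $ i $ j)"

definition alpha :: "nat \<Rightarrow> ('m \<times> nat \<Rightarrow> 'm \<times> nat \<Rightarrow> real) \<Rightarrow> real poly ^ 'm ^ 'm" where
  "alpha e Q = (if odd e then pmult [:0, 1:] (Lambda (e - 1) Q) else Lambda e Q)"

definition beta :: "nat \<Rightarrow> ('m \<times> nat \<Rightarrow> 'm \<times> nat \<Rightarrow> real) \<Rightarrow> real poly ^ 'm ^ 'm" where
  "beta e Q = (if odd e then pmult [:1, -1:] (Lambda (e - 1) Q)
               else if e = 0 then 0
               else pmult ([:0, 1:] * [:1, -1:]) (Lambda (e - 2) Q))"

definition alpha_idx :: "nat \<Rightarrow> ('m \<times> nat) set" where
  "alpha_idx e = UNIV \<times> {..<if odd e then (e + 1) div 2 else e div 2 + 1}"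

definition beta_idx :: "nat \<Rightarrow> ('m \<times> nat) set" where
  "beta_idx e = UNIV \<times> {..<if odd e then (e + 1) div 2 else e div 2}"

text \<open>The element \<open>0\<close> only matters when all data matrices vanish.\<close>

definition sdp_degree ::
  "real poly ^ 'm ^ 'm \<Rightarrow> ('n::finite \<Rightarrow> real poly ^ 'm ^ 'm)
    \<Rightarrow> ('n \<Rightarrow> real poly poly ^ 'm ^ 'm) \<Rightarrow> nat \<Rightarrow> nat" where
  "sdp_degree A0 A D d = Max ({0}
     \<union> (if A0 = 0 then {} else {pmat_degree A0})
     \<union> {pmat_degree (A i) + d | i. A i \<noteq> 0}
     \<union> {pmat_total_degree (D i) + d + 1 | i. D i \<noteq> 0})"

definition sdp_feasible ::
  "real poly ^ 'm ^ 'm \<Rightarrow> ('n::finite \<Rightarrow> real poly ^ 'm ^ 'm)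
    \<Rightarrow> ('n \<Rightarrow> real poly poly ^ 'm ^ 'm) \<Rightarrow> nat
    \<Rightarrow> real poly ^ 'n \<Rightarrow> ('m \<times> nat \<Rightarrow> 'm \<times> nat \<Rightarrow> real)
    \<Rightarrow> ('m \<times> nat \<Rightarrow> 'm \<times> nat \<Rightarrow> real) \<Rightarrow> bool" where
  "sdp_feasible A0 A D d p Q1 Q2 \<longleftrightarrow>
     (let e = sdp_degree A0 A D d in
       p \<in> poly_vecs d \<and> psd_on (alpha_idx e) Q1 \<and> psd_on (beta_idx e) Q2 \<and>
       (\<forall>t\<in>{0..1}. F_op A0 A D (pvec_eval p) t = pmat_eval (alpha e Q1 + beta e Q2) t))"

end

theory Submission
  imports Defs
begin

text \<open>For a polynomial \<open>x\<close> of degree at most \<open>d\<close>, the matrix \<open>F x(t)\<close> is a symmetric polynomial matrix of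
degree at most \<open>d'\<close> (\<open>F_op_pvec_eval\<close>, \<open>degree_F_poly\<close>), and by continuity it is positive semidefinite
almost everywhere on \<open>[0, 1]\<close> iff it is so everywhere (\<open>tv_feasible_pvec_eval_iff\<close>). The theorem thus
says that a polynomial matrix \<open>M\<close> of degree at most \<open>e\<close> is positive semidefinite on \<open>[0, 1]\<close> iff it has
the form \<open>\<alpha>\<^sub>e(Q\<^sub>1) + \<beta>\<^sub>e(Q\<^sub>2)\<close> with semidefinite Gram matrices. One direction holds because the weights
\<open>t\<close>, \<open>1-t\<close> and \<open>t(1-t)\<close> are nonnegative on the interval (\<open>psd_certificate\<close>); the other one
(\<open>interval_certificate_exists\<close>) is the substance.

The substitution \<open>t = s\<^sup>2/(1+s\<^sup>2)\<close> reduces it to the real line (\<open>interval_sos\<close>). There, a polynomial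
matrix \<open>P\<close> that is semidefinite for all real \<open>t\<close> is a sum of squares, with the expected degree
bounds (\<open>psd_poly_is_sum_of_squares\<close>). The proof is by induction on the number of rows plus the sum
of degree bounds \<open>e\<^sub>i\<close> of the rows, where \<open>deg P\<^sub>i\<^sub>j \<le> e\<^sub>i + e\<^sub>j\<close>. Subtract \<open>l y\<^sub>i\<^sup>2\<close> from the quadratic
form, with \<open>l\<close> as large as semidefiniteness permits. By compactness of the projective line the
difference is singular at some real point or at infinity (\<open>critical_subtraction\<close>); reversing the
polynomials moves infinity to \<open>0\<close>. At a singular point \<open>t\<^sub>0\<close>, a constant change of
basis makes a diagonal entry vanish. It then vanishes doubly and its row and column vanish as well, so that
\<open>t - t\<^sub>0\<close> can be divided out of that row and column, or the whole row is zero if its degree bound is \<open>0\<close>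
(\<open>sos_of_isotropic_point\<close>). Degree bounds are kept through all steps, so no
denominators ever have to be removed.\<close>

section \<open>Quadratic forms and positive semidefinite matrices\<close>

definition qform :: "'a set \<Rightarrow> ('a \<Rightarrow> 'a \<Rightarrow> real) \<Rightarrow> ('a \<Rightarrow> real) \<Rightarrow> real" where
  "qform I M y = (\<Sum>a\<in>I. \<Sum>b\<in>I. y a * M a b * y b)"

lemma psd_on_iff_qform:
  "psd_on I M \<longleftrightarrow> (\<forall>a\<in>I. \<forall>b\<in>I. M a b = M b a) \<and> (\<forall>y. 0 \<le> qform I M y)"
  by (simp add: psd_on_def qform_def)

lemma sum_rotate:
  "(\<Sum>k\<in>K. \<Sum>l\<in>L. \<Sum>m\<in>M. f k l m) = (\<Sum>l\<in>L. \<Sum>m\<in>M. \<Sum>k\<in>K. f k l m)"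
proof -
  have "(\<Sum>k\<in>K. \<Sum>l\<in>L. \<Sum>m\<in>M. f k l m) = (\<Sum>l\<in>L. \<Sum>k\<in>K. \<Sum>m\<in>M. f k l m)"
    by (rule sum.swap)
  also have "\<dots> = (\<Sum>l\<in>L. \<Sum>m\<in>M. \<Sum>k\<in>K. f k l m)"
    by (rule sum.cong[OF refl], rule sum.swap)
  finally show ?thesis .
qed

lemma sum_swap_pairs:
  "(\<Sum>j\<in>I. \<Sum>k\<in>I. \<Sum>l\<in>J. \<Sum>m\<in>J. f j k l m) = (\<Sum>l\<in>J. \<Sum>m\<in>J. \<Sum>j\<in>I. \<Sum>k\<in>I. f j k l m)"
proof -
  have "(\<Sum>j\<in>I. \<Sum>k\<in>I. \<Sum>l\<in>J. \<Sum>m\<in>J. f j k l m) = (\<Sum>j\<in>I. \<Sum>l\<in>J. \<Sum>m\<in>J. \<Sum>k\<in>I. f j k l m)"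
    by (rule sum.cong[OF refl], rule sum_rotate)
  also have "\<dots> = (\<Sum>l\<in>J. \<Sum>m\<in>J. \<Sum>j\<in>I. \<Sum>k\<in>I. f j k l m)"
    by (rule sum_rotate)
  finally show ?thesis .
qed

lemma sum_sum_delta:
  fixes f :: "'a \<Rightarrow> 'a \<Rightarrow> 'b::comm_semiring_1"
  assumes "finite I" "i \<in> I" "j \<in> I"
  shows "(\<Sum>a\<in>I. \<Sum>b\<in>I. of_bool (a = i) * (of_bool (b = j) * f a b)) = f i j"
proof -
  have "(\<Sum>a\<in>I. \<Sum>b\<in>I. of_bool (a = i) * (of_bool (b = j) * f a b))
      = (\<Sum>a\<in>I. of_bool (a = i) * (\<Sum>b\<in>I. of_bool (b = j) * f a b))"
    by (simp only: sum_distrib_left)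
  also have "\<dots> = (\<Sum>a\<in>I. if a = i then f a j else 0)"
    using assms by (intro sum.cong refl) (simp add: of_bool_def if_distrib[of "\<lambda>x. x * _"] cong: if_cong)
  also have "\<dots> = f i j" using assms by simp
  finally show ?thesis .
qed

lemma qform_add_multiple_unit:
  assumes "finite I" "i \<in> I" "\<forall>a\<in>I. \<forall>b\<in>I. M a b = M b a"
  shows "qform I M (\<lambda>a. y a + x * of_bool (a = i))
    = qform I M y + 2 * x * (\<Sum>b\<in>I. M i b * y b) + x\<^sup>2 * M i i"
proof -
  have *: "(y a + x * of_bool (a = i)) * M a b * (y b + x * of_bool (b = i))
     = y a * M a b * y b + x * (of_bool (a = i) * (M a b * y b))
       + x * (of_bool (b = i) * (M a b * y a)) + x\<^sup>2 * (of_bool (a = i) * (of_bool (b = i) * M a b))" for a b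
    by (simp add: algebra_simps power2_eq_square)
  have p1: "(\<Sum>a\<in>I. \<Sum>b\<in>I. of_bool (a = i) * (M a b * y b)) = (\<Sum>b\<in>I. M i b * y b)"
    using assms(1,2) by (subst sum.swap) (simp add: of_bool_def if_distrib[of "\<lambda>x. x * _"] sum.delta cong: if_cong)
  have p2: "(\<Sum>a\<in>I. \<Sum>b\<in>I. of_bool (b = i) * (M a b * y a)) = (\<Sum>b\<in>I. M i b * y b)"
    using assms by (simp add: of_bool_def if_distrib[of "\<lambda>x. x * _"] sum.delta cong: if_cong)
  have p3: "(\<Sum>a\<in>I. \<Sum>b\<in>I. of_bool (a = i) * (of_bool (b = i) * M a b)) = M i i"
    using assms(1,2,2) by (rule sum_sum_delta)
  have "(\<Sum>a\<in>I. \<Sum>b\<in>I. x * (of_bool (a = i) * (M a b * y b))) = x * (\<Sum>b\<in>I. M i b * y b)"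
    by (simp only: p1[symmetric] sum_distrib_left)
  moreover have "(\<Sum>a\<in>I. \<Sum>b\<in>I. x * (of_bool (b = i) * (M a b * y a))) = x * (\<Sum>b\<in>I. M i b * y b)"
    by (simp only: p2[symmetric] sum_distrib_left)
  moreover have "(\<Sum>a\<in>I. \<Sum>b\<in>I. x\<^sup>2 * (of_bool (a = i) * (of_bool (b = i) * M a b))) = x\<^sup>2 * M i i"
    unfolding p3[symmetric] by (simp only: sum_distrib_left)
  ultimately show ?thesis
    unfolding qform_def * sum.distrib by simp
qed

text \<open>For a positive semidefinite \<open>M\<close>, moving from an isotropic vector \<open>v\<close> by \<open>x\<close> in direction \<open>i\<close> changes
the form by \<open>2 x (M v)\<^sub>i + x\<^sup>2 M\<^sub>i\<^sub>i\<close>; this is nonnegative for both signs of a small \<open>x\<close> only if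
\<open>(M v)\<^sub>i = 0\<close>.\<close>

lemma psd_on_isotropic_imp_kernel:
  assumes "finite I" "psd_on I M" "qform I M v = 0" "i \<in> I"
  shows "(\<Sum>b\<in>I. M i b * v b) = 0"
proof -
  define c where "c = (\<Sum>b\<in>I. M i b * v b)"
  define m where "m = M i i"
  have sym: "\<forall>a\<in>I. \<forall>b\<in>I. M a b = M b a" and nn: "\<And>y. 0 \<le> qform I M y"
    using assms(2) by (auto simp: psd_on_iff_qform)
  have q: "0 \<le> 2 * x * c + x\<^sup>2 * m" for x
    using nn[of "\<lambda>a. v a + x * of_bool (a = i)"] qform_add_multiple_unit[OF assms(1,4) sym, of v x] assms(3)
    by (simp add: c_def m_def)
  have "0 \<le> 0 + x\<^sup>2 * m" for x
    using nn[of "\<lambda>a. 0 + x * of_bool (a = i)"] qform_add_multiple_unit[OF assms(1,4) sym, of "\<lambda>_. 0" x]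
    by (simp add: qform_def m_def)
  from this[of 1] have m: "m \<ge> 0" by simp
  \<comment> \<open>the quadratic in \<open>x\<close> is evaluated at \<open>x = -c/(m+1)\<close>; adding 1 to \<open>m\<close> keeps the denominator positive when \<open>m = 0\<close>\<close>
  have "0 \<le> (m+1)\<^sup>2 * (2 * (-c/(m+1)) * c + (-c/(m+1))\<^sup>2 * m)"
    using q[of "-c/(m+1)"] by simp
  also have "\<dots> = - (c\<^sup>2 * (m + 2))"
    using m by (simp add: field_simps power2_eq_square add_nonneg_eq_0_iff)
  finally have "c\<^sup>2 * (m + 2) \<le> 0" by simp
  with m have "c\<^sup>2 \<le> 0" by (simp add: mult_le_0_iff)
  thus ?thesis by (simp add: c_def)
qed

section \<open>Polynomial matrices and their sum of squares decompositions\<close>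

lemma smult_sum_right: "smult c (\<Sum>i\<in>A. f i) = (\<Sum>i\<in>A. smult c (f i))"
  by (rule poly_eqI) (simp add: coeff_sum sum_distrib_left)

lemma poly_eqI_off_finite:
  fixes p q :: "real poly"
  assumes "infinite S" "\<And>x. x \<in> S \<Longrightarrow> poly p x = poly q x"
  shows "p = q"
proof (rule ccontr)
  assume "p \<noteq> q"
  then have "finite {x. poly (p - q) x = 0}" by (intro poly_roots_finite) simp
  then have "finite S" by (rule rev_finite_subset) (use assms(2) in auto)
  with assms(1) show False by simp
qed

lemma continuous_qform_poly: "isCont (\<lambda>t. qform I (\<lambda>a b. poly (P a b) t) y) t"
  unfolding qform_def by (intro continuous_intros)

lemma continuous_nonneg_at_limit:
  fixes f :: "real \<Rightarrow> real"
  assumes "isCont f t0" "\<And>t. t \<noteq> t0 \<Longrightarrow> 0 \<le> f t"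
  shows "0 \<le> f t0"
proof (rule tendsto_lowerbound)
  show "f \<midarrow>t0\<rightarrow> f t0" using assms(1) by (simp add: isCont_def)
  show "\<forall>\<^sub>F t in at t0. 0 \<le> f t" using assms(2) by (auto simp: eventually_at intro!: exI[of _ 1])
qed simp

text \<open>Semidefiniteness passes to limits. This settles the one point that is lost when a polynomial matrix is
divided by a power of \<open>t - t\<^sub>0\<close>, and the point \<open>0\<close> of a reversed matrix.\<close>

lemma psd_on_poly_at_limit:
  assumes "\<And>t. t \<noteq> t0 \<Longrightarrow> psd_on I (\<lambda>a b. poly (P a b) t)"
  shows "psd_on I (\<lambda>a b. poly (P a b) t0)"
proof -
  have "poly (P a b) t0 = poly (P b a) t0" if "a \<in> I" "b \<in> I" for a b
  proof -
    have "P a b = P b a"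
    proof (rule poly_eqI_off_finite)
      show "infinite (- {t0})" by (simp add: infinite_UNIV_char_0)
    qed (use assms that in \<open>auto simp: psd_on_iff_qform\<close>)
    thus ?thesis by simp
  qed
  moreover have "0 \<le> qform I (\<lambda>a b. poly (P a b) t0) y" for y
    by (rule continuous_nonneg_at_limit[OF continuous_qform_poly])
       (use assms in \<open>auto simp: psd_on_iff_qform\<close>)
  ultimately show ?thesis by (auto simp: psd_on_iff_qform)
qed

definition psd_poly :: "'a set \<Rightarrow> ('a \<Rightarrow> 'a \<Rightarrow> real poly) \<Rightarrow> bool" where
  "psd_poly I P \<longleftrightarrow> (\<forall>t. psd_on I (\<lambda>a b. poly (P a b) t))"

text \<open>One degree bound per row, rather than one for the whole matrix: the induction below divides a single row
and column by a linear factor, and only that row's bound drops. A matrix of degree at most \<open>2 n\<close> has the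
constant profile \<open>n\<close>.\<close>

definition degree_profile :: "'a set \<Rightarrow> ('a \<Rightarrow> nat) \<Rightarrow> ('a \<Rightarrow> 'a \<Rightarrow> real poly) \<Rightarrow> bool" where
  "degree_profile I e P \<longleftrightarrow> (\<forall>a\<in>I. \<forall>b\<in>I. degree (P a b) \<le> e a + e b)"

text \<open>The form \<open>\<Sum>\<^sub>a\<^sub>b y\<^sub>a P\<^sub>a\<^sub>b(t) y\<^sub>b\<close> is the sum over \<open>r\<close> of the squares of \<open>\<Sum>\<^sub>a y\<^sub>a g\<^sub>r\<^sub>a(t)\<close>.\<close>

definition sum_of_squares :: "'a set \<Rightarrow> ('a \<Rightarrow> nat) \<Rightarrow> ('a \<Rightarrow> 'a \<Rightarrow> real poly) \<Rightarrow> bool" where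
  "sum_of_squares I e P \<longleftrightarrow> (\<exists>(N::nat) g. (\<forall>r<N. \<forall>a\<in>I. degree (g r a) \<le> e a) \<and>
     (\<forall>a\<in>I. \<forall>b\<in>I. P a b = (\<Sum>r<N. g r a * g r b)))"

lemma psd_poly_sym: "psd_poly I P \<Longrightarrow> a \<in> I \<Longrightarrow> b \<in> I \<Longrightarrow> P a b = P b a"
  by (rule poly_ext) (auto simp: psd_poly_def psd_on_iff_qform)

lemma psd_poly_subset:
  assumes "psd_poly I P" "J \<subseteq> I" "finite I"
  shows "psd_poly J P"
  unfolding psd_poly_def psd_on_iff_qform
proof (intro allI conjI ballI)
  fix t y
  have "0 \<le> qform I (\<lambda>a b. poly (P a b) t) (\<lambda>a. if a \<in> J then y a else 0)"
    using assms(1) by (auto simp: psd_poly_def psd_on_iff_qform)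
  also have "\<dots> = qform J (\<lambda>a b. poly (P a b) t) y"
    unfolding qform_def using assms(2,3)
    by (intro sum.mono_neutral_cong_right ballI) (auto intro!: sum.neutral)
  finally show "0 \<le> qform J (\<lambda>a b. poly (P a b) t) y" .
next
  fix t a b assume "a \<in> J" "b \<in> J"
  with assms(2) have "a \<in> I" "b \<in> I" by auto
  thus "poly (P a b) t = poly (P b a) t" using psd_poly_sym[OF assms(1)] by metis
qed

text \<open>A constant change of basis \<open>T\<close> with inverse \<open>S\<close> transports decompositions. The condition on \<open>S\<close> says
that a row only receives rows whose degree bound does not exceed its own, so that the profile survives.\<close>

lemma sum_of_squares_basis_change:
  assumes "finite I" "sum_of_squares I e P'"
    and P': "\<And>a b. a \<in> I \<Longrightarrow> b \<in> I \<Longrightarrow> P' a b = (\<Sum>j\<in>I. \<Sum>k\<in>I. smult (T a j * T b k) (P j k))"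
    and inv: "\<And>a l. a \<in> I \<Longrightarrow> l \<in> I \<Longrightarrow> (\<Sum>j\<in>I. S a j * T j l) = of_bool (a = l)"
    and S: "\<And>a j. a \<in> I \<Longrightarrow> j \<in> I \<Longrightarrow> S a j \<noteq> 0 \<Longrightarrow> e j \<le> e a"
  shows "sum_of_squares I e P"
proof -
  obtain N g where deg: "\<forall>r<(N::nat). \<forall>a\<in>I. degree (g r a) \<le> e a"
    and g: "\<forall>a\<in>I. \<forall>b\<in>I. P' a b = (\<Sum>r<N. g r a * g r b)"
    using assms(2) by (auto simp: sum_of_squares_def)
  define h where "h r a = (\<Sum>j\<in>I. smult (S a j) (g r j))" for r a
  have "degree (h r a) \<le> e a" if "r < N" "a \<in> I" for r a
    unfolding h_def
  proof (rule degree_sum_le[OF assms(1)])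
    fix j assume "j \<in> I"
    thus "degree (smult (S a j) (g r j)) \<le> e a"
      using S[of a j] deg that by (cases "S a j = 0") (auto intro: le_trans)
  qed
  moreover have "P a b = (\<Sum>r<N. h r a * h r b)" if a: "a \<in> I" and b: "b \<in> I" for a b
  proof -
    have "(\<Sum>r<N. h r a * h r b) = (\<Sum>r<N. \<Sum>j\<in>I. \<Sum>k\<in>I. smult (S a j * S b k) (g r j * g r k))"
      unfolding h_def sum_product by (simp add: mult_ac)
    also have "\<dots> = (\<Sum>j\<in>I. \<Sum>k\<in>I. \<Sum>r<N. smult (S a j * S b k) (g r j * g r k))"
      by (subst sum.swap) (intro sum.cong refl sum.swap)
    also have "\<dots> = (\<Sum>j\<in>I. \<Sum>k\<in>I. smult (S a j * S b k) (P' j k))"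
      using g by (simp add: smult_sum_right)
    also have "\<dots> = (\<Sum>j\<in>I. \<Sum>k\<in>I. \<Sum>l\<in>I. \<Sum>m\<in>I. smult ((S a j * T j l) * (S b k * T k m)) (P l m))"
      using P' by (simp add: smult_sum_right mult_ac)
    also have "\<dots> = (\<Sum>l\<in>I. \<Sum>m\<in>I. \<Sum>j\<in>I. \<Sum>k\<in>I. smult ((S a j * T j l) * (S b k * T k m)) (P l m))"
      by (rule sum_swap_pairs)
    also have "\<dots> = (\<Sum>l\<in>I. \<Sum>m\<in>I. smult ((\<Sum>j\<in>I. S a j * T j l) * (\<Sum>k\<in>I. S b k * T k m)) (P l m))"
      by (simp add: sum_product smult_sum)
    also have "\<dots> = (\<Sum>l\<in>I. \<Sum>m\<in>I. of_bool (l = a) * (of_bool (m = b) * P l m))"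
      using inv[OF a] inv[OF b] by (intro sum.cong refl) auto
    also have "\<dots> = P a b"
      using assms(1) a b by (rule sum_sum_delta)
    finally show ?thesis ..
  qed
  ultimately show ?thesis unfolding sum_of_squares_def by blast
qed

lemma psd_poly_basis_change:
  assumes "finite I" "psd_poly I P"
  shows "psd_poly I (\<lambda>a b. \<Sum>j\<in>I. \<Sum>k\<in>I. smult (T a j * T b k) (P j k))"
  unfolding psd_poly_def psd_on_iff_qform
proof (intro allI conjI ballI)
  fix t y
  have "0 \<le> qform I (\<lambda>a b. poly (P a b) t) (\<lambda>j. \<Sum>a\<in>I. y a * T a j)"
    using assms(2) by (auto simp: psd_poly_def psd_on_iff_qform)
  also have "\<dots> = (\<Sum>j\<in>I. \<Sum>k\<in>I. \<Sum>a\<in>I. \<Sum>b\<in>I. y a * (T a j * T b k * poly (P j k) t) * y b)"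
    unfolding qform_def by (simp add: sum_distrib_left sum_distrib_right mult_ac)
  also have "\<dots> = (\<Sum>a\<in>I. \<Sum>b\<in>I. \<Sum>j\<in>I. \<Sum>k\<in>I. y a * (T a j * T b k * poly (P j k) t) * y b)"
    by (rule sum_swap_pairs)
  also have "\<dots> = qform I (\<lambda>a b. poly (\<Sum>j\<in>I. \<Sum>k\<in>I. smult (T a j * T b k) (P j k)) t) y"
    unfolding qform_def by (simp add: poly_sum sum_distrib_left sum_distrib_right mult_ac)
  finally show "0 \<le> qform I (\<lambda>a b. poly (\<Sum>j\<in>I. \<Sum>k\<in>I. smult (T a j * T b k) (P j k)) t) y" .
next
  fix t a b assume "a \<in> I" "b \<in> I"
  have "(\<Sum>j\<in>I. \<Sum>k\<in>I. smult (T a j * T b k) (P j k)) = (\<Sum>j\<in>I. \<Sum>k\<in>I. smult (T a k * T b j) (P k j))"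
    by (rule sum.swap)
  also have "\<dots> = (\<Sum>j\<in>I. \<Sum>k\<in>I. smult (T b j * T a k) (P j k))"
    using psd_poly_sym[OF assms(2)] by (intro sum.cong refl) (simp add: mult_ac)
  finally show "poly (\<Sum>j\<in>I. \<Sum>k\<in>I. smult (T a j * T b k) (P j k)) t = poly (\<Sum>j\<in>I. \<Sum>k\<in>I. smult (T b j * T a k) (P j k)) t"
    by simp
qed

section \<open>Reduction at a point where the matrix is singular\<close>

text \<open>The induction hypothesis of the main induction. The number of rows is part of the measure because a
row with degree bound \<open>0\<close> can be removed but not divided.\<close>

definition has_smaller_sos :: "'a set \<Rightarrow> ('a \<Rightarrow> nat) \<Rightarrow> bool" where
  "has_smaller_sos I e \<longleftrightarrow> (\<forall>J e' P. J \<subseteq> I \<longrightarrow> card J + sum e' J < card I + sum e I \<longrightarrow>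
     psd_poly J P \<longrightarrow> degree_profile J e' P \<longrightarrow> sum_of_squares J e' P)"

text \<open>A zero diagonal entry of a semidefinite matrix forces a zero row and column.\<close>

lemma sos_drop_null_row:
  assumes I: "finite I" "i \<in> I" and psd: "psd_poly I P" and prof: "degree_profile I e P"
    and null: "P i i = 0" and IH: "has_smaller_sos I e"
  shows "sum_of_squares I e P"
proof -
  have row: "P i a = 0" if "a \<in> I" for a
  proof (rule poly_ext)
    fix t
    have "psd_on I (\<lambda>a b. poly (P a b) t)" using psd by (simp add: psd_poly_def)
    moreover have "qform I (\<lambda>a b. poly (P a b) t) (\<lambda>a. 0 + 1 * of_bool (a = i)) = 0"
      using psd I null by (subst qform_add_multiple_unit) (auto simp: psd_poly_def psd_on_iff_qform qform_def)
    ultimately have "(\<Sum>b\<in>I. poly (P a b) t * (0 + 1 * of_bool (b = i))) = 0"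
      using I that by (intro psd_on_isotropic_imp_kernel) auto
    hence "poly (P a i) t = 0" using I by (simp add: of_bool_def if_distrib[of "\<lambda>x. _ * x"] cong: if_cong)
    thus "poly (P i a) t = poly 0 t" using psd_poly_sym[OF psd I(2) that] by simp
  qed
  have "card (I - {i}) + sum e (I - {i}) < card I + sum e I"
    using card_Diff1_less[OF I] sum.remove[OF I, of e] by simp
  moreover have "psd_poly (I - {i}) P" by (rule psd_poly_subset[OF psd _ I(1)]) blast
  moreover have "degree_profile (I - {i}) e P" using prof by (auto simp: degree_profile_def)
  ultimately have "sum_of_squares (I - {i}) e P"
    using IH unfolding has_smaller_sos_def by blast
  then obtain N g where deg: "\<forall>r<(N::nat). \<forall>a\<in>I-{i}. degree (g r a) \<le> e a"
    and g: "\<forall>a\<in>I-{i}. \<forall>b\<in>I-{i}. P a b = (\<Sum>r<N. g r a * g r b)"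
    by (auto simp: sum_of_squares_def)
  define h where "h r a = (if a = i then 0 else g r a)" for r a
  have "\<forall>r<N. \<forall>a\<in>I. degree (h r a) \<le> e a" using deg by (auto simp: h_def)
  moreover have col: "P a i = 0" if "a \<in> I" for a
    using row[OF that] psd_poly_sym[OF psd that I(2)] by simp
  moreover have "\<forall>a\<in>I. \<forall>b\<in>I. P a b = (\<Sum>r<N. h r a * h r b)"
  proof (intro ballI)
    fix a b assume "a \<in> I" "b \<in> I"
    thus "P a b = (\<Sum>r<N. h r a * h r b)"
      using g row col by (cases "a = i"; cases "b = i") (simp_all add: h_def)
  qed
  ultimately show ?thesis unfolding sum_of_squares_def by blast
qed

text \<open>If the diagonal entry \<open>P\<^sub>i\<^sub>i\<close> vanishes at \<open>t\<^sub>0\<close>, then so does the whole row, and \<open>P\<^sub>i\<^sub>i\<close> vanishes to second order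
since it is nonnegative. Hence \<open>t - t\<^sub>0\<close> can be divided out of row \<open>i\<close> and out of column \<open>i\<close>. The
quotient is again semidefinite, with a smaller profile, and multiplying the entries of its squares in
position \<open>i\<close> by \<open>t - t\<^sub>0\<close> gives squares for \<open>P\<close>.\<close>

lemma sos_divide_row:
  assumes I: "finite I" "i \<in> I" and psd: "psd_poly I P" and prof: "degree_profile I e P"
    and null: "poly (P i i) t0 = 0" and e: "e i > 0" and IH: "has_smaller_sos I e"
  shows "sum_of_squares I e P"
proof -
  define L where "L = [:- t0, 1:]"
  have L: "poly L t = t - t0" "degree L = 1" "L \<noteq> 0" for t by (auto simp: L_def)
  have row: "L dvd P a i" if "a \<in> I" for a
  proof -
    have "psd_on I (\<lambda>a b. poly (P a b) t0)" using psd by (simp add: psd_poly_def)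
    moreover have "qform I (\<lambda>a b. poly (P a b) t0) (\<lambda>a. 0 + 1 * of_bool (a = i)) = 0"
      using psd I null by (subst qform_add_multiple_unit) (auto simp: psd_poly_def psd_on_iff_qform qform_def)
    ultimately have "(\<Sum>b\<in>I. poly (P a b) t0 * (0 + 1 * of_bool (b = i))) = 0"
      using I that by (intro psd_on_isotropic_imp_kernel) auto
    hence "poly (P a i) t0 = 0" using I by (simp add: of_bool_def if_distrib[of "\<lambda>x. _ * x"] cong: if_cong)
    thus ?thesis by (simp add: poly_eq_0_iff_dvd L_def)
  qed
  have diag_nonneg: "0 \<le> poly (P i i) t" for t
  proof -
    have "0 \<le> qform I (\<lambda>a b. poly (P a b) t) (\<lambda>a. 0 + 1 * of_bool (a = i))"
      using psd by (auto simp: psd_poly_def psd_on_iff_qform)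
    also have "\<dots> = poly (P i i) t"
      using psd I by (subst qform_add_multiple_unit) (auto simp: psd_poly_def psd_on_iff_qform qform_def)
    finally show ?thesis .
  qed
  have diag: "L * L dvd P i i"
  proof -
    obtain q where q: "P i i = L * q" using row[OF I(2)] by (elim dvdE)
    \<comment> \<open>\<open>t\<^sub>0\<close> is a minimum of the nonnegative polynomial \<open>P i i\<close>\<close>
    have "poly (pderiv (P i i)) t0 = 0"
      by (rule DERIV_local_min[OF poly_DERIV, of 1]) (auto simp: null diag_nonneg)
    hence "poly q t0 = 0" by (simp add: q pderiv_mult L) (simp add: L_def pderiv_pCons)
    hence "L dvd q" by (simp add: poly_eq_0_iff_dvd L_def)
    thus ?thesis by (simp add: q)
  qed
  define w where "w a = (if a = i then L else 1)" for a
  define e' where "e' a = (if a = i then e i - 1 else e a)" for a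
  have w0: "w a \<noteq> 0" and degw: "degree (w a) + e' a = e a" for a
    using L e by (auto simp: w_def e'_def)
  define P' where "P' a b = P a b div (w a * w b)" for a b
  have P: "P a b = w a * w b * P' a b" if "a \<in> I" "b \<in> I" for a b
  proof -
    have "w a * w b dvd P a b"
      using row[of a] row[of b] diag psd_poly_sym[OF psd, of i b] I(2) that
      by (cases "a = i"; cases "b = i") (simp_all add: w_def)
    thus ?thesis by (simp add: P'_def)
  qed
  have "degree_profile I e' P'"
    unfolding degree_profile_def
  proof (intro ballI)
    fix a b assume ab: "a \<in> I" "b \<in> I"
    show "degree (P' a b) \<le> e' a + e' b"
    proof (cases "P' a b = 0")
      case False
      hence "degree (P a b) = degree (w a) + degree (w b) + degree (P' a b)"
        using w0 by (simp add: P[OF ab] degree_mult_eq)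
      moreover have "degree (P a b) \<le> e a + e b" using prof ab by (auto simp: degree_profile_def)
      ultimately show ?thesis using degw[of a] degw[of b] by linarith
    qed simp
  qed
  moreover have "psd_poly I P'"
    unfolding psd_poly_def
  proof
    have off: "psd_on I (\<lambda>a b. poly (P' a b) t)" if "t \<noteq> t0" for t
      unfolding psd_on_iff_qform
    proof (intro conjI ballI allI)
      fix a b assume ab: "a \<in> I" "b \<in> I"
      have "w a * w b * P' a b = P a b" by (rule P[OF ab, symmetric])
      also have "\<dots> = P b a" by (rule psd_poly_sym[OF psd ab])
      also have "\<dots> = w b * w a * P' b a" by (rule P[OF ab(2,1)])
      also have "\<dots> = w a * w b * P' b a" by (simp only: mult.commute[of "w b"])
      finally have "P' a b = P' b a"
        by (subst (asm) mult_left_cancel) (use w0 in simp_all)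
      thus "poly (P' a b) t = poly (P' b a) t" by (rule arg_cong)
    next
      fix y
      have nz: "poly (w a) t \<noteq> 0" for a using that by (simp add: w_def L)
      have "0 \<le> qform I (\<lambda>a b. poly (P a b) t) (\<lambda>a. y a / poly (w a) t)"
        using psd by (auto simp: psd_poly_def psd_on_iff_qform)
      also have "\<dots> = qform I (\<lambda>a b. poly (P' a b) t) y"
        unfolding qform_def using nz by (intro sum.cong refl) (simp add: P)
      finally show "0 \<le> qform I (\<lambda>a b. poly (P' a b) t) y" .
    qed
    show "psd_on I (\<lambda>a b. poly (P' a b) t)" for t
      using off psd_on_poly_at_limit[of t0 I P'] by (cases "t = t0") auto
  qed
  moreover have "card I + sum e' I < card I + sum e I"
    using I e sum.remove[of I i e] sum.remove[of I i e'] by (simp add: e'_def)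
  ultimately have "sum_of_squares I e' P'" using IH unfolding has_smaller_sos_def by blast
  then obtain N g where deg: "\<forall>r<(N::nat). \<forall>a\<in>I. degree (g r a) \<le> e' a"
    and g: "\<forall>a\<in>I. \<forall>b\<in>I. P' a b = (\<Sum>r<N. g r a * g r b)"
    by (auto simp: sum_of_squares_def)
  have "degree (w a * g r a) \<le> e a" if "r < N" "a \<in> I" for r a
    using degree_mult_le[of "w a" "g r a"] degw[of a] deg that by fastforce
  moreover have "P a b = (\<Sum>r<N. (w a * g r a) * (w b * g r b))" if "a \<in> I" "b \<in> I" for a b
    using P[OF that] g that by (simp add: sum_distrib_left mult_ac)
  ultimately show ?thesis
    unfolding sum_of_squares_def by (intro exI[of _ N] exI[of _ "\<lambda>r a. w a * g r a"]) auto
qed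

text \<open>An isotropic vector \<open>v\<close> of \<open>P(t\<^sub>0)\<close> becomes a coordinate vector after a constant change of basis. It
replaces the basis vector \<open>i\<close> with the largest degree bound among those that occur in \<open>v\<close>, since then
the profile is preserved; afterwards row \<open>i\<close> can be removed or divided.\<close>

lemma sos_of_isotropic_point:
  assumes I: "finite I" and psd: "psd_poly I P" and prof: "degree_profile I e P"
    and v: "a0 \<in> I" "v a0 \<noteq> 0" "qform I (\<lambda>a b. poly (P a b) t0) v = 0"
    and IH: "has_smaller_sos I e"
  shows "sum_of_squares I e P"
proof -
  obtain i where i: "i \<in> I" "v i \<noteq> 0" and imax: "\<And>j. j \<in> I \<Longrightarrow> v j \<noteq> 0 \<Longrightarrow> e j \<le> e i"
  proof -
    have "finite {a\<in>I. v a \<noteq> 0}" "{a\<in>I. v a \<noteq> 0} \<noteq> {}" using I v by auto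
    then obtain i where "i \<in> {a\<in>I. v a \<noteq> 0}" "\<forall>j\<in>{a\<in>I. v a \<noteq> 0}. e j \<le> e i"
      using Max_in[of "e ` {a\<in>I. v a \<noteq> 0}"] Max_ge[of "e ` {a\<in>I. v a \<noteq> 0}"]
      by (smt (verit) finite_imageI image_iff image_is_empty)
    thus ?thesis using that by auto
  qed
  define u where "u j = v j / v i" for j
  have ui: "u i = 1" and u: "u j \<noteq> 0 \<Longrightarrow> j \<in> I \<Longrightarrow> e j \<le> e i" for j
    using i imax by (auto simp: u_def)
  define T where "T a j = (if a = i then u j else of_bool (a = j))" for a j
  define S where "S a j = (if a = i then of_bool (j = i) - u j * of_bool (j \<noteq> i) else of_bool (a = j))" for a j
  define P' where "P' a b = (\<Sum>j\<in>I. \<Sum>k\<in>I. smult (T a j * T b k) (P j k))" for a b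
  have psd': "psd_poly I P'" unfolding P'_def by (rule psd_poly_basis_change[OF I psd])
  have prof': "degree_profile I e P'"
    unfolding degree_profile_def P'_def
  proof (intro ballI degree_sum_le[OF I])
    fix a b j k assume *: "a \<in> I" "b \<in> I" "j \<in> I" "k \<in> I"
    have T: "T a j \<noteq> 0 \<Longrightarrow> e j \<le> e a" "T b k \<noteq> 0 \<Longrightarrow> e k \<le> e b"
      using u * by (auto simp: T_def split: if_splits)
    have "degree (P j k) \<le> e j + e k" using prof * by (auto simp: degree_profile_def)
    thus "degree (smult (T a j * T b k) (P j k)) \<le> e a + e b"
      using T by (cases "T a j = 0 \<or> T b k = 0") auto
  qed
  have "poly (P' i i) t0 = (\<Sum>a\<in>I. \<Sum>b\<in>I. (v a * poly (P a b) t0 * v b) / (v i * v i))"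
    unfolding P'_def poly_sum by (simp add: T_def u_def mult_ac)
  also have "\<dots> = 0"
    using v(3) by (simp add: qform_def sum_divide_distrib[symmetric])
  finally have null: "poly (P' i i) t0 = 0" .
  have "sum_of_squares I e P'"
  proof (cases "e i = 0")
    case True
    hence "degree (P' i i) = 0" using bspec[OF bspec[OF prof'[unfolded degree_profile_def] i(1)] i(1)] by simp
    then obtain c where "P' i i = [:c:]" by (elim degree_eq_zeroE)
    with null have "P' i i = 0" by simp
    thus ?thesis by (rule sos_drop_null_row[OF I i(1) psd' prof' _ IH])
  next
    case False
    thus ?thesis using sos_divide_row[OF I i(1) psd' prof' null _ IH] by simp
  qed
  thus ?thesis
  proof (rule sum_of_squares_basis_change[OF I, where S = S and T = T])
    show "e j \<le> e a" if "a \<in> I" "j \<in> I" "S a j \<noteq> 0" for a j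
      using that u[of j] by (cases "j = i") (auto simp: S_def split: if_splits)
    show "(\<Sum>j\<in>I. S a j * T j l) = of_bool (a = l)" if al: "a \<in> I" "l \<in> I" for a l
    proof (cases "a = i")
      case False
      thus ?thesis using I al
        by (simp add: S_def of_bool_def if_distrib[of "\<lambda>x. x * _"] T_def cong: if_cong)
    next
      case True
      have "(\<Sum>j\<in>I. S a j * T j l) = S i i * T i l + (\<Sum>j\<in>I-{i}. S a j * T j l)"
        using I al True by (simp add: sum.remove[of I i])
      also have "(\<Sum>j\<in>I-{i}. S a j * T j l) = (\<Sum>j\<in>I-{i}. if j = l then - u j else 0)"
        by (intro sum.cong) (auto simp: S_def T_def True)
      finally show ?thesis using I al ui by (auto simp: True S_def T_def)
    qed
  qed (simp add: P'_def)
qed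

section \<open>The point at infinity\<close>

text \<open>\<open>reversal n p\<close> is \<open>t\<^sup>n p(1/t)\<close>. Reversing a whole matrix along its profile exchanges the points \<open>0\<close> and
\<open>\<infinity>\<close>: a reversed matrix that is singular at \<open>0\<close> comes from a matrix whose leading coefficients, taken
relative to the profile, are singular.\<close>

definition reversal :: "nat \<Rightarrow> real poly \<Rightarrow> real poly" where
  "reversal n p = monom 1 (n - degree p) * reflect_poly p"

lemma poly_reversal:
  assumes "degree p \<le> n" "z \<noteq> 0"
  shows "poly (reversal n p) z = z ^ n * poly p (1 / z)"
  using assms by (simp add: reversal_def poly_monom poly_reflect_poly_nz inverse_eq_divide
      mult.assoc[symmetric] power_add[symmetric])

lemma degree_reversal: "degree p \<le> n \<Longrightarrow> degree (reversal n p) \<le> n"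
  unfolding reversal_def
  by (rule le_trans[OF degree_mult_le]) (use degree_reflect_poly_le[of p] in \<open>simp add: degree_monom_eq\<close>)

definition reverse_matrix :: "('a \<Rightarrow> nat) \<Rightarrow> ('a \<Rightarrow> 'a \<Rightarrow> real poly) \<Rightarrow> 'a \<Rightarrow> 'a \<Rightarrow> real poly" where
  "reverse_matrix e P a b = reversal (e a + e b) (P a b)"

lemma qform_reverse_matrix:
  assumes "degree_profile I e P" "t \<noteq> 0"
  shows "qform I (\<lambda>a b. poly (reverse_matrix e P a b) t) y
    = qform I (\<lambda>a b. poly (P a b) (1 / t)) (\<lambda>a. t ^ e a * y a)"
  using assms unfolding qform_def
  by (intro sum.cong refl) (simp add: reverse_matrix_def degree_profile_def poly_reversal power_add mult_ac)

lemma degree_profile_reverse_matrix: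
  "degree_profile I e P \<Longrightarrow> degree_profile I e (reverse_matrix e P)"
  by (simp add: degree_profile_def reverse_matrix_def degree_reversal)

lemma psd_poly_reverse_matrix:
  assumes "psd_poly I P" "degree_profile I e P"
  shows "psd_poly I (reverse_matrix e P)"
proof -
  have off: "psd_on I (\<lambda>a b. poly (reverse_matrix e P a b) t)" if "t \<noteq> 0" for t
    unfolding psd_on_iff_qform qform_reverse_matrix[OF assms(2) that]
    using assms(1) psd_poly_sym[OF assms(1)]
    by (auto simp: psd_poly_def psd_on_iff_qform reverse_matrix_def add.commute)
  show ?thesis
    unfolding psd_poly_def
  proof
    show "psd_on I (\<lambda>a b. poly (reverse_matrix e P a b) t)" for t
      using off psd_on_poly_at_limit[of 0 I "reverse_matrix e P"] by (cases "t = 0") auto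
  qed
qed

text \<open>Reversing the squares of the reversed matrix gives squares for the matrix itself. The two sides
are compared at all \<open>t \<noteq> 0\<close>, which is enough for polynomials.\<close>

lemma sos_of_reverse_matrix:
  assumes prof: "degree_profile I e P" and sos: "sum_of_squares I e (reverse_matrix e P)"
  shows "sum_of_squares I e P"
proof -
  obtain N g where deg: "\<forall>r<(N::nat). \<forall>a\<in>I. degree (g r a) \<le> e a"
    and g: "\<forall>a\<in>I. \<forall>b\<in>I. reverse_matrix e P a b = (\<Sum>r<N. g r a * g r b)"
    using sos by (auto simp: sum_of_squares_def)
  have "P a b = (\<Sum>r<N. reversal (e a) (g r a) * reversal (e b) (g r b))" if ab: "a \<in> I" "b \<in> I" for a b
  proof (rule poly_eqI_off_finite)
    show "infinite (- {0::real})" by (simp add: infinite_UNIV_char_0)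
    fix t :: real assume "t \<in> - {0}"
    hence t: "t \<noteq> 0" "1 / t \<noteq> 0" by auto
    have "degree (P a b) \<le> e a + e b" using prof ab by (simp add: degree_profile_def)
    hence "poly (P a b) t = t ^ (e a + e b) * poly (reverse_matrix e P a b) (1 / t)"
      using t by (simp add: reverse_matrix_def poly_reversal power_divide)
    also have "\<dots> = (\<Sum>r<N. (t ^ e a * poly (g r a) (1 / t)) * (t ^ e b * poly (g r b) (1 / t)))"
      using g ab by (simp add: poly_sum sum_distrib_left power_add mult_ac)
    also have "\<dots> = poly (\<Sum>r<N. reversal (e a) (g r a) * reversal (e b) (g r b)) t"
      using deg ab t by (simp add: poly_sum poly_reversal)
    finally show "poly (P a b) t = poly (\<Sum>r<N. reversal (e a) (g r a) * reversal (e b) (g r b)) t" .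
  qed
  thus ?thesis
    using deg unfolding sum_of_squares_def
    by (intro exI[of _ N] exI[of _ "\<lambda>r a. reversal (e a) (g r a)"]) (auto simp: degree_reversal)
qed

section \<open>Semidefinite polynomial matrices on the real line are sums of squares\<close>

text \<open>Compactness of \<open>[-1, 1]\<close> times the unit sphere of the vectors supported on \<open>I\<close>.\<close>

lemma positive_definite_uniform:
  fixes P :: "'a::finite \<Rightarrow> 'a \<Rightarrow> real poly"
  assumes pos: "\<And>t y. t \<in> {-1..1} \<Longrightarrow> \<exists>a\<in>I. y a \<noteq> 0 \<Longrightarrow> 0 < qform I (\<lambda>a b. poly (P a b) t) y"
  obtains \<epsilon> where "\<epsilon> > 0"
    "\<And>t y i. t \<in> {-1..1} \<Longrightarrow> i \<in> I \<Longrightarrow> \<epsilon> * (y i)\<^sup>2 \<le> qform I (\<lambda>a b. poly (P a b) t) y"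
proof (cases "I = {}")
  case True
  thus ?thesis using that[of 1] by auto
next
  case False
  then obtain i0 where i0: "i0 \<in> I" by auto
  define Y where "Y = sphere (0::real^'a) 1 \<inter> (\<Inter>a\<in>-I. {y. y $ a = 0})"
  define f where "f = (\<lambda>(t, y::real^'a). qform I (\<lambda>a b. poly (P a b) t) (($) y))"
  have "compact ({-1..1::real} \<times> Y)"
    unfolding Y_def by (intro compact_Times compact_Int_closed compact_Icc compact_sphere closed_INT ballI closed_Collect_eq continuous_intros)
  moreover have "axis i0 1 \<in> Y"
    using i0 by (auto simp: Y_def axis_def norm_eq_sqrt_inner inner_vec_def if_distrib[of "\<lambda>x. x * _"] cong: if_cong)
  moreover have "continuous_on ({-1..1} \<times> Y) f"
    unfolding f_def qform_def split_def by (intro continuous_intros)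
  moreover have "(0, axis i0 1) \<in> {-1..1::real} \<times> Y"
    using calculation(2) by simp
  ultimately obtain z where z: "z \<in> {-1..1} \<times> Y" and zmin: "\<forall>x \<in> {-1..1} \<times> Y. f z \<le> f x"
    using continuous_attains_inf[of "{-1..1} \<times> Y" f] by blast
  define m where "m = f z"
  have "m > 0"
  proof -
    obtain t y where ty: "z = (t, y)" by (cases z)
    have "\<exists>a\<in>I. y $ a \<noteq> 0"
    proof (rule ccontr)
      assume "\<not> ?thesis"
      hence "y = 0" using z ty by (auto simp: Y_def vec_eq_iff)
      thus False using z ty by (auto simp: Y_def)
    qed
    thus ?thesis unfolding m_def f_def ty using pos[of t "($) y"] z ty by auto
  qed
  moreover have "m * (y i)\<^sup>2 \<le> qform I (\<lambda>a b. poly (P a b) t) y"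
    if t: "t \<in> {-1..1}" and i: "i \<in> I" for t y i
  proof -
    define x :: "real^'a" where "x = (\<chi> a. if a \<in> I then y a else 0)"
    have qx: "qform I (\<lambda>a b. poly (P a b) t) (\<lambda>a. c * x $ a) = c\<^sup>2 * qform I (\<lambda>a b. poly (P a b) t) y" for c
      unfolding qform_def sum_distrib_left by (intro sum.cong refl) (simp add: x_def power2_eq_square)
    have yi: "y i = x $ i" using i by (simp add: x_def)
    show ?thesis
    proof (cases "x = 0")
      case True
      hence "qform I (\<lambda>a b. poly (P a b) t) y = 0" using qx[of 1] by (simp add: qform_def)
      thus ?thesis using True yi by simp
    next
      case False
      define n where "n = norm x"
      have n: "n > 0" using False by (simp add: n_def)
      have "(1/n) *\<^sub>R x \<in> Y" using n by (auto simp: Y_def n_def x_def)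
      hence "m \<le> f (t, (1/n) *\<^sub>R x)" using zmin t by (auto simp: m_def)
      also have "\<dots> = qform I (\<lambda>a b. poly (P a b) t) (\<lambda>a. (1/n) * x $ a)"
        by (simp add: f_def qform_def)
      also have "\<dots> = (1/n)\<^sup>2 * qform I (\<lambda>a b. poly (P a b) t) y" by (rule qx)
      finally have "m * n\<^sup>2 \<le> qform I (\<lambda>a b. poly (P a b) t) y"
        using n by (simp add: field_simps)
      moreover have "(y i)\<^sup>2 \<le> n\<^sup>2"
        using component_le_norm_cart[of x i] by (simp add: yi n_def abs_le_square_iff[symmetric])
      ultimately show ?thesis
        using mult_left_mono[of "(y i)\<^sup>2" "n\<^sup>2" m] \<open>m > 0\<close> by linarith
    qed
  qed
  ultimately show ?thesis by (rule that)
qed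

text \<open>The matrix whose quadratic form is that of \<open>P\<close> minus \<open>l y\<^sub>i\<^sup>2\<close>.\<close>

definition subtract_at :: "'a \<Rightarrow> real \<Rightarrow> ('a \<Rightarrow> 'a \<Rightarrow> real poly) \<Rightarrow> 'a \<Rightarrow> 'a \<Rightarrow> real poly" where
  "subtract_at i l P a b = P a b - of_bool (a = i) * (of_bool (b = i) * [:l:])"

lemma qform_subtract_at:
  assumes "finite I" "i \<in> I"
  shows "qform I (\<lambda>a b. poly (subtract_at i l P a b) t) y = qform I (\<lambda>a b. poly (P a b) t) y - l * (y i)\<^sup>2"
proof -
  have "qform I (\<lambda>a b. poly (subtract_at i l P a b) t) y
     = (\<Sum>a\<in>I. \<Sum>b\<in>I. y a * poly (P a b) t * y b - of_bool (a = i) * (of_bool (b = i) * (y a * l * y b)))"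
    unfolding qform_def by (intro sum.cong refl) (simp add: subtract_at_def algebra_simps of_bool_def)
  thus ?thesis
    using sum_sum_delta[OF assms(1,2,2), of "\<lambda>a b. y a * l * y b"]
    by (simp only: sum_subtractf qform_def) (simp add: power2_eq_square mult_ac)
qed

lemma psd_poly_subtract_at_iff:
  assumes "finite I" "i \<in> I" "psd_poly I P"
  shows "psd_poly I (subtract_at i l P) \<longleftrightarrow> (\<forall>t y. l * (y i)\<^sup>2 \<le> qform I (\<lambda>a b. poly (P a b) t) y)"
proof -
  have "subtract_at i l P a b = subtract_at i l P b a" if "a \<in> I" "b \<in> I" for a b
    using psd_poly_sym[OF assms(3) that] by (simp add: subtract_at_def mult_ac)
  thus ?thesis
    unfolding psd_poly_def psd_on_iff_qform qform_subtract_at[OF assms(1,2)] by auto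
qed

text \<open>Let \<open>l\<close> be the largest constant for which subtracting \<open>l y\<^sub>i\<^sup>2\<close> keeps \<open>P\<close> semidefinite. Then the
difference is singular somewhere on the projective line: otherwise the uniform bound, applied to the
difference on \<open>[-1, 1]\<close> and to its reversal, which covers \<open>\<bar>t\<bar> \<ge> 1\<close> including \<open>\<infinity>\<close>, would leave
room to subtract a little more.\<close>

lemma critical_subtraction:
  fixes P :: "'a::finite \<Rightarrow> 'a \<Rightarrow> real poly"
  assumes i: "i \<in> I" and psd: "psd_poly I P" and prof: "degree_profile I e P"
  obtains l t v a where "l \<ge> 0" "psd_poly I (subtract_at i l P)" "a \<in> I" "v a \<noteq> 0"
    "qform I (\<lambda>a b. poly (subtract_at i l P a b) t) v = 0 \<or>
     qform I (\<lambda>a b. poly (reverse_matrix e (subtract_at i l P) a b) t) v = 0"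
proof -
  have I: "finite I" by simp
  define X where "X = {l. 0 \<le> l \<and> psd_poly I (subtract_at i l P)}"
  note iff = psd_poly_subtract_at_iff[OF I i]
  have nn: "0 \<le> qform I (\<lambda>a b. poly (P a b) t) y" for t y
    using psd by (auto simp: psd_poly_def psd_on_iff_qform)
  have "0 \<in> X" using nn psd by (auto simp: X_def iff)
  have "bdd_above X"
  proof (rule bdd_aboveI)
    fix l assume "l \<in> X"
    hence "\<forall>t y. l * (y i)\<^sup>2 \<le> qform I (\<lambda>a b. poly (P a b) t) y"
      unfolding X_def iff[OF psd] by blast
    from spec[OF spec[OF this, of 0], of "\<lambda>_. 1"]
    have "l * 1\<^sup>2 \<le> qform I (\<lambda>a b. poly (P a b) 0) (\<lambda>_. 1)" .
    thus "l \<le> qform I (\<lambda>a b. poly (P a b) 0) (\<lambda>_. 1)" by simp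
  qed
  define s where "s = Sup X"
  define Q where "Q = subtract_at i s P"
  have s0: "s \<ge> 0" unfolding s_def using \<open>0 \<in> X\<close> \<open>bdd_above X\<close> by (rule cSup_upper)
  have psdQ: "psd_poly I Q"
    unfolding Q_def iff[OF psd]
  proof (intro allI)
    fix t y
    show "s * (y i)\<^sup>2 \<le> qform I (\<lambda>a b. poly (P a b) t) y"
    proof (cases "y i = 0")
      case False
      have "s \<le> qform I (\<lambda>a b. poly (P a b) t) y / (y i)\<^sup>2"
        unfolding s_def
      proof (rule cSup_least)
        fix l assume "l \<in> X"
        thus "l \<le> qform I (\<lambda>a b. poly (P a b) t) y / (y i)\<^sup>2"
          using False by (simp add: X_def iff[OF psd] pos_le_divide_eq)
      qed (use \<open>0 \<in> X\<close> in auto)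
      thus ?thesis using False by (simp add: pos_le_divide_eq)
    qed (simp add: nn)
  qed
  have profQ: "degree_profile I e Q"
    unfolding degree_profile_def Q_def subtract_at_def
    using prof by (auto simp: degree_profile_def of_bool_def intro!: degree_diff_le)
  show ?thesis
  proof (rule ccontr)
    assume not_thesis: "\<not> thesis"
    note witness = that[OF s0 psdQ[unfolded Q_def], folded Q_def]
    have no: "qform I (\<lambda>a b. poly (Q a b) t) v \<noteq> 0 \<and> qform I (\<lambda>a b. poly (reverse_matrix e Q a b) t) v \<noteq> 0"
      if v: "\<exists>a\<in>I. v a \<noteq> 0" for t v
    proof -
      from v obtain a where "a \<in> I" "v a \<noteq> 0" by blast
      from witness[where v = v and t = t, OF this] not_thesis show ?thesis by blast
    qed
    have psdR: "psd_poly I (reverse_matrix e Q)" by (rule psd_poly_reverse_matrix[OF psdQ profQ])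
    have pos: "0 < qform I (\<lambda>a b. poly (Q a b) t) v" "0 < qform I (\<lambda>a b. poly (reverse_matrix e Q a b) t) v"
      if "\<exists>a\<in>I. v a \<noteq> 0" for t v
      using no[OF that, of t] psdQ psdR unfolding psd_poly_def psd_on_iff_qform order_less_le
      by (blast dest: not_sym)+
    obtain \<epsilon>1 where e1: "\<epsilon>1 > 0"
      "\<And>t y i. t \<in> {-1..1} \<Longrightarrow> i \<in> I \<Longrightarrow> \<epsilon>1 * (y i)\<^sup>2 \<le> qform I (\<lambda>a b. poly (Q a b) t) y"
      using positive_definite_uniform[of I Q] pos(1) by metis
    obtain \<epsilon>2 where e2: "\<epsilon>2 > 0"
      "\<And>t y i. t \<in> {-1..1} \<Longrightarrow> i \<in> I \<Longrightarrow> \<epsilon>2 * (y i)\<^sup>2 \<le> qform I (\<lambda>a b. poly (reverse_matrix e Q a b) t) y"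
      using positive_definite_uniform[of I "reverse_matrix e Q"] pos(2) by metis
    define \<epsilon> where "\<epsilon> = min \<epsilon>1 \<epsilon>2"
    have eps: "\<epsilon> > 0" "\<epsilon> \<le> \<epsilon>1" "\<epsilon> \<le> \<epsilon>2" using e1 e2 by (auto simp: \<epsilon>_def)
    have lower: "\<epsilon> * (y i)\<^sup>2 \<le> qform I (\<lambda>a b. poly (Q a b) t) y" for t y
    proof (cases "t \<in> {-1..1}")
      case True
      thus ?thesis using e1(2)[OF True i, of y] mult_right_mono[OF eps(2), of "(y i)\<^sup>2"] by simp
    next
      case False
      hence t: "t \<noteq> 0" "1 / t \<noteq> 0" "\<bar>t\<bar> \<ge> 1" and t1: "1 / t \<in> {-1..1}" by (auto simp: field_simps split: if_splits)
      \<comment> \<open>reversal scales the coordinate \<open>i\<close> by a power of \<open>t\<close>, which only enlarges it here\<close>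
      have "1 \<le> (\<bar>t\<bar> ^ e i)\<^sup>2" by (intro one_le_power t)
      hence "1 \<le> (t ^ e i)\<^sup>2" by (simp flip: power_abs)
      hence "\<epsilon> * (y i)\<^sup>2 \<le> \<epsilon> * (t ^ e i * y i)\<^sup>2"
        using eps mult_right_mono[of 1 "(t ^ e i)\<^sup>2" "(y i)\<^sup>2"] by (simp add: power_mult_distrib)
      also have "\<dots> \<le> \<epsilon>2 * (t ^ e i * y i)\<^sup>2" by (intro mult_right_mono eps) simp
      also have "\<dots> \<le> qform I (\<lambda>a b. poly (reverse_matrix e Q a b) (1 / t)) (\<lambda>a. t ^ e a * y a)"
        using e2(2)[OF t1 i, of "\<lambda>a. t ^ e a * y a"] .
      also have "\<dots> = qform I (\<lambda>a b. poly (Q a b) t) y"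
        using t by (simp add: qform_reverse_matrix[OF profQ t(2)] power_divide)
      finally show ?thesis .
    qed
    have "(s + \<epsilon>) * (y i)\<^sup>2 \<le> qform I (\<lambda>a b. poly (P a b) t) y" for t y
      using lower[of y t] by (simp add: Q_def qform_subtract_at[OF I i] algebra_simps)
    hence "s + \<epsilon> \<in> X" using s0 eps by (auto simp: X_def iff[OF psd])
    hence "s + \<epsilon> \<le> s" unfolding s_def using \<open>bdd_above X\<close> by (intro cSup_upper)
    with eps show False by simp
  qed
qed

lemma sum_of_squares_add_at:
  assumes "l \<ge> 0" "i \<in> I" "sum_of_squares I e (subtract_at i l P)"
  shows "sum_of_squares I e P"
proof -
  obtain N g where deg: "\<forall>r<(N::nat). \<forall>a\<in>I. degree (g r a) \<le> e a"
    and g: "\<forall>a\<in>I. \<forall>b\<in>I. subtract_at i l P a b = (\<Sum>r<N. g r a * g r b)"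
    using assms(3) by (auto simp: sum_of_squares_def)
  define h where "h r a = (if r = N then of_bool (a = i) * [:sqrt l:] else g r a)" for r a
  have "P a b = (\<Sum>r<Suc N. h r a * h r b)" if "a \<in> I" "b \<in> I" for a b
  proof -
    have "P a b = (\<Sum>r<N. g r a * g r b) + of_bool (a = i) * (of_bool (b = i) * [:l:])"
      using g[rule_format, OF that] by (simp add: subtract_at_def diff_eq_eq)
    also have "(\<Sum>r<N. g r a * g r b) = (\<Sum>r<N. h r a * h r b)" by (simp add: h_def)
    also have "of_bool (a = i) * (of_bool (b = i) * [:l:]) = h N a * h N b"
      using assms(1) by (simp add: h_def of_bool_def)
    finally show ?thesis by simp
  qed
  moreover have "\<forall>r<Suc N. \<forall>a\<in>I. degree (h r a) \<le> e a"
    using deg by (auto simp: h_def less_Suc_eq of_bool_def)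
  ultimately show ?thesis unfolding sum_of_squares_def by blast
qed

text \<open>A square is split off until the rest is singular at a real point or at infinity; there the rest loses
a row or a degree, so the induction hypothesis applies to it.\<close>

theorem psd_poly_is_sum_of_squares:
  fixes P :: "'a::finite \<Rightarrow> 'a \<Rightarrow> real poly"
  assumes "psd_poly I P" "degree_profile I e P"
  shows "sum_of_squares I e P"
  using assms
proof (induction "card I + sum e I" arbitrary: I e P rule: less_induct)
  case less
  have IH: "has_smaller_sos I e" using less.hyps by (auto simp: has_smaller_sos_def)
  show ?case
  proof (cases "I = {}")
    case True
    thus ?thesis by (auto simp: sum_of_squares_def)
  next
    case False
    then obtain i where i: "i \<in> I" by auto
    obtain l t v a where l: "l \<ge> 0" and psdQ: "psd_poly I (subtract_at i l P)" and v: "a \<in> I" "v a \<noteq> 0"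
      and sing: "qform I (\<lambda>a b. poly (subtract_at i l P a b) t) v = 0 \<or>
     qform I (\<lambda>a b. poly (reverse_matrix e (subtract_at i l P) a b) t) v = 0"
      by (rule critical_subtraction[OF i less.prems])
    have profQ: "degree_profile I e (subtract_at i l P)"
      unfolding degree_profile_def subtract_at_def
      using less.prems(2) by (auto simp: degree_profile_def of_bool_def intro!: degree_diff_le)
    from sing have "sum_of_squares I e (subtract_at i l P)"
    proof
      assume "qform I (\<lambda>a b. poly (subtract_at i l P a b) t) v = 0"
      thus ?thesis by (rule sos_of_isotropic_point[where v = v, OF finite psdQ profQ v _ IH])
    next
      assume "qform I (\<lambda>a b. poly (reverse_matrix e (subtract_at i l P) a b) t) v = 0"
      hence "sum_of_squares I e (reverse_matrix e (subtract_at i l P))"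
        by (rule sos_of_isotropic_point[where v = v, OF finite psd_poly_reverse_matrix[OF psdQ profQ]
              degree_profile_reverse_matrix[OF profQ] v _ IH])
      thus ?thesis by (rule sos_of_reverse_matrix[OF profQ])
    qed
    thus ?thesis by (rule sum_of_squares_add_at[OF l i])
  qed
qed

section \<open>Semidefinite polynomial matrices on the unit interval\<close>

lemma poly_eq_sum_atMost:
  fixes p :: "real poly"
  assumes "degree p \<le> n"
  shows "poly p x = (\<Sum>k\<le>n. coeff p k * x ^ k)"
  unfolding poly_altdef using assms by (intro sum.mono_neutral_left) (auto simp: coeff_eq_0)

lemma sum_split_parity:
  fixes c :: "nat \<Rightarrow> real"
  shows "(\<Sum>k\<le>2 * h + 1. c k * s ^ k)
    = (\<Sum>k\<le>h. c (2 * k) * (s\<^sup>2) ^ k) + s * (\<Sum>k\<le>h. c (2 * k + 1) * (s\<^sup>2) ^ k)"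
proof (induction h)
  case (Suc h)
  have "(\<Sum>k\<le>2 * Suc h + 1. c k * s ^ k)
      = (\<Sum>k\<le>2 * h + 1. c k * s ^ k) + c (2 * Suc h) * s ^ (2 * Suc h) + c (2 * Suc h + 1) * s ^ (2 * Suc h + 1)"
    by (simp add: numeral_eq_Suc)
  moreover have "s ^ (2 * Suc h) = (s\<^sup>2) ^ Suc h" by (rule power_mult)
  moreover have "s ^ (2 * Suc h + 1) = s * (s\<^sup>2) ^ Suc h" unfolding power_mult[symmetric] by simp
  ultimately show ?case unfolding Suc by (simp only: sum.atMost_Suc) (simp only: algebra_simps)
qed simp

text \<open>\<open>\<Sum>\<^sub>k c\<^sub>k t\<^sup>k (1-t)\<^sup>h\<^sup>-\<^sup>k\<close>: the homogenization of \<open>\<Sum>\<^sub>k c\<^sub>k x\<^sup>k\<close> in degree \<open>h\<close>, evaluated at \<open>(t, 1-t)\<close>.\<close>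

definition bernstein_sum :: "nat \<Rightarrow> (nat \<Rightarrow> real) \<Rightarrow> real poly" where
  "bernstein_sum h c = (\<Sum>k\<le>h. monom (c k) k * [:1, -1:] ^ (h - k))"

lemma degree_bernstein_sum: "degree (bernstein_sum h c) \<le> h"
  unfolding bernstein_sum_def
proof (rule degree_sum_le)
  fix k assume "k \<in> {..h}"
  have "degree ([:1, -1::real:] ^ (h - k)) \<le> h - k"
    using degree_power_le[of "[:1, -1::real:]" "h - k"] by simp
  thus "degree (monom (c k) k * [:1, -1:] ^ (h - k)) \<le> h"
    using degree_mult_le[of "monom (c k) k" "[:1, -1:] ^ (h - k)"] degree_monom_le[of "c k" k] \<open>k \<in> {..h}\<close>
    by simp
qed simp

lemma poly_bernstein_sum:
  assumes "t \<noteq> 1"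
  shows "poly (bernstein_sum h c) t = (1 - t) ^ h * (\<Sum>k\<le>h. c k * (t / (1 - t)) ^ k)"
  unfolding bernstein_sum_def poly_sum sum_distrib_left
proof (rule sum.cong[OF refl])
  fix k assume "k \<in> {..h}"
  hence "(1 - t) ^ h = (1 - t) ^ (h - k) * (1 - t) ^ k" by (simp flip: power_add)
  thus "poly (monom (c k) k * [:1, -1:] ^ (h - k)) t = (1 - t) ^ h * (c k * (t / (1 - t)) ^ k)"
    using assms by (simp add: poly_monom power_divide)
qed

text \<open>The substitution \<open>t = s\<^sup>2/(1+s\<^sup>2)\<close> maps the real line onto \<open>[0, 1)\<close>, and \<open>R(s) = (1+s\<^sup>2)\<^sup>n P(t)\<close> is a
semidefinite polynomial matrix of degree at most \<open>2 n\<close>, hence a sum of squares of forms with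
coefficients \<open>g\<close> of degree at most \<open>n\<close>. Split \<open>g(s) = a(s\<^sup>2) + s b(s\<^sup>2)\<close>. Since \<open>R\<close> is even, the mixed terms cancel and \<open>R\<close> is the sum of the
\<open>a a + s\<^sup>2 b b\<close>. Returning to \<open>t\<close>, with \<open>s\<^sup>2 = t/(1-t)\<close>, the factor \<open>(1-t)\<^sup>n\<close> clears the denominators of \<open>a\<close>
and \<open>b\<close>; the weights \<open>t\<close>, \<open>1-t\<close> or \<open>t(1-t)\<close> are what is left over, depending on the parity of \<open>n\<close>.\<close>

lemma interval_sos:
  fixes P :: "'a::finite \<Rightarrow> 'a \<Rightarrow> real poly"
  assumes psd: "\<And>t. t \<in> {0..1} \<Longrightarrow> psd_on UNIV (\<lambda>a b. poly (P a b) t)"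
    and deg: "\<And>a b. degree (P a b) \<le> n"
  obtains N :: nat and E O' where "\<And>r a. r < N \<Longrightarrow> degree (E r a) \<le> n div 2"
    "\<And>r a. r < N \<Longrightarrow> degree (O' r a) \<le> (n - 1) div 2"
    "\<And>a b. P a b =
      (if odd n then [:0, 1:] * (\<Sum>r<N. O' r a * O' r b) + [:1, -1:] * (\<Sum>r<N. E r a * E r b)
       else if n = 0 then (\<Sum>r<N. E r a * E r b)
       else (\<Sum>r<N. E r a * E r b) + ([:0, 1:] * [:1, -1:]) * (\<Sum>r<N. O' r a * O' r b))"
proof -
  define R where "R a b = (\<Sum>k\<le>n. monom (coeff (P a b) k) (2 * k) * [:1, 0, 1:] ^ (n - k))" for a b
  have R: "poly (R a b) s = (1 + s\<^sup>2) ^ n * poly (P a b) (s\<^sup>2 / (1 + s\<^sup>2))" for a b s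
    unfolding R_def poly_sum poly_eq_sum_atMost[OF deg] sum_distrib_left
  proof (rule sum.cong[OF refl])
    fix k assume "k \<in> {..n}"
    hence "(1 + s\<^sup>2) ^ n = (1 + s\<^sup>2) ^ (n - k) * (1 + s\<^sup>2) ^ k" by (simp flip: power_add)
    moreover have "1 + s\<^sup>2 \<noteq> 0" by (smt (verit) zero_le_power2)
    ultimately show "poly (monom (coeff (P a b) k) (2 * k) * [:1, 0, 1:] ^ (n - k)) s =
         (1 + s\<^sup>2) ^ n * (coeff (P a b) k * (s\<^sup>2 / (1 + s\<^sup>2)) ^ k)"
      by (simp add: poly_monom power_divide power_mult power2_eq_square)
  qed
  have unit: "s\<^sup>2 / (1 + s\<^sup>2) \<in> {0..1}" for s :: real
    by (simp add: divide_le_eq add_pos_nonneg)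
  have "degree (R a b) \<le> n + n" for a b
    unfolding R_def
  proof (rule degree_sum_le)
    fix k assume "k \<in> {..n}"
    have "degree ([:1, 0, 1::real:] ^ (n - k)) \<le> 2 * (n - k)"
      using degree_power_le[of "[:1, 0, 1::real:]" "n - k"] by simp
    thus "degree (monom (coeff (P a b) k) (2 * k) * [:1, 0, 1:] ^ (n - k)) \<le> n + n"
      using degree_mult_le[of "monom (coeff (P a b) k) (2 * k)" "[:1, 0, 1:] ^ (n - k)"]
        degree_monom_le[of "coeff (P a b) k" "2 * k"] \<open>k \<in> {..n}\<close> by simp
  qed simp
  hence prof: "degree_profile UNIV (\<lambda>_. n) R" by (simp add: degree_profile_def)
  have "psd_poly UNIV R"
    unfolding psd_poly_def psd_on_iff_qform
  proof (intro allI conjI ballI)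
    fix a b s show "poly (R a b) s = poly (R b a) s"
      using psd[OF unit[of s]] by (simp add: R psd_on_iff_qform)
  next
    fix s y
    have "qform UNIV (\<lambda>a b. poly (R a b) s) y
        = (1 + s\<^sup>2) ^ n * qform UNIV (\<lambda>a b. poly (P a b) (s\<^sup>2 / (1 + s\<^sup>2))) y"
      unfolding qform_def sum_distrib_left R by (intro sum.cong refl) (simp add: mult_ac)
    thus "0 \<le> qform UNIV (\<lambda>a b. poly (R a b) s) y"
      using psd[OF unit[of s]] by (simp add: psd_on_iff_qform)
  qed
  from psd_poly_is_sum_of_squares[OF this prof] obtain N g where
    degg: "\<And>r a. r < (N::nat) \<Longrightarrow> degree (g r a) \<le> n"
    and g: "\<And>a b. R a b = (\<Sum>r<N. g r a * g r b)"
    by (auto simp: sum_of_squares_def)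
  define h where "h = n div 2"
  define h' where "h' = (n - 1) div 2"
  define E where "E r a = bernstein_sum h (\<lambda>k. coeff (g r a) (2 * k))" for r a
  define O' where "O' r a = bernstein_sum h' (\<lambda>k. coeff (g r a) (2 * k + 1))" for r a
  have main: "poly (P a b) t = (1 - t) ^ n *
     ((\<Sum>r<N. (poly (E r a) t / (1 - t) ^ h) * (poly (E r b) t / (1 - t) ^ h))
      + (t / (1 - t)) * (\<Sum>r<N. (poly (O' r a) t / (1 - t) ^ h') * (poly (O' r b) t / (1 - t) ^ h')))"
    if t: "t \<in> {0<..<1}" for t a b
  proof -
    define s where "s = sqrt (t / (1 - t))"
    have s2: "s\<^sup>2 = t / (1 - t)" using t by (simp add: s_def)
    have s2': "(- s)\<^sup>2 = s\<^sup>2" by simp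
    have s3: "1 + s\<^sup>2 = 1 / (1 - t)" "s\<^sup>2 / (1 + s\<^sup>2) = t" using t by (auto simp: s2 field_simps)
    define ev where "ev r a = poly (E r a) t / (1 - t) ^ h" for r a
    define od where "od r a = poly (O' r a) t / (1 - t) ^ h'" for r a
    have ev: "ev r a = (\<Sum>k\<le>h. coeff (g r a) (2 * k) * (s\<^sup>2) ^ k)" for r a
      using t by (simp add: ev_def E_def poly_bernstein_sum s2)
    \<comment> \<open>for even \<open>n\<close> the top odd coefficient, of index \<open>n + 1\<close>, vanishes, so both sums may run to \<open>h\<close>\<close>
    have od: "od r a = (\<Sum>k\<le>h. coeff (g r a) (2 * k + 1) * (s\<^sup>2) ^ k)" if "r < N" for r a
    proof -
      have "od r a = (\<Sum>k\<le>h'. coeff (g r a) (2 * k + 1) * (s\<^sup>2) ^ k)"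
        using t by (simp add: od_def O'_def poly_bernstein_sum s2)
      also have "\<dots> = (\<Sum>k\<le>h. coeff (g r a) (2 * k + 1) * (s\<^sup>2) ^ k)"
      proof (rule sum.mono_neutral_left)
        show "\<forall>k\<in>{..h} - {..h'}. coeff (g r a) (2 * k + 1) * (s\<^sup>2) ^ k = 0"
        proof
          fix k assume "k \<in> {..h} - {..h'}"
          hence "n < 2 * k + 1" by (auto simp: h'_def h_def)
          hence "coeff (g r a) (2 * k + 1) = 0" using degg[OF that, of a] by (intro coeff_eq_0) simp
          thus "coeff (g r a) (2 * k + 1) * (s\<^sup>2) ^ k = 0" by simp
        qed
      qed (auto simp: h'_def h_def)
      finally show ?thesis .
    qed
    have split: "poly (g r a) s = ev r a + s * od r a \<and> poly (g r a) (- s) = ev r a - s * od r a"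
      if r: "r < N" for r a
    proof -
      have "degree (g r a) \<le> 2 * h + 1" using degg[OF r, of a] by (simp add: h_def)
      from poly_eq_sum_atMost[OF this] show ?thesis
        unfolding sum_split_parity s2' ev od[OF r] by simp
    qed
    have "poly (R a b) (- s) = poly (R a b) s" by (simp only: R s2')
    hence "2 * poly (R a b) s = poly (R a b) s + poly (R a b) (- s)" by simp
    also have "\<dots> = (\<Sum>r<N. (ev r a + s * od r a) * (ev r b + s * od r b) + (ev r a - s * od r a) * (ev r b - s * od r b))"
      by (simp add: g poly_sum split sum.distrib)
    also have "\<dots> = (\<Sum>r<N. 2 * (ev r a * ev r b + s\<^sup>2 * (od r a * od r b)))"
      by (intro sum.cong refl) (simp add: algebra_simps power2_eq_square)
    also have "\<dots> = 2 * ((\<Sum>r<N. ev r a * ev r b) + s\<^sup>2 * (\<Sum>r<N. od r a * od r b))"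
      by (simp add: sum.distrib sum_distrib_left distrib_left)
    finally have "poly (R a b) s = (\<Sum>r<N. ev r a * ev r b) + s\<^sup>2 * (\<Sum>r<N. od r a * od r b)" by simp
    moreover have "poly (R a b) s = (1 / (1 - t)) ^ n * poly (P a b) t"
      by (subst R, subst s3(2), subst s3(1), rule refl)
    hence "poly (P a b) t = (1 - t) ^ n * poly (R a b) s"
      using t by (simp add: power_divide)
    ultimately show ?thesis unfolding s2 ev_def od_def by (simp only:)
  qed
  have inf: "infinite {0<..<1::real}" by (simp add: infinite_Ioo)
  show ?thesis
  proof (rule that)
    show "degree (E r a) \<le> n div 2" for r a by (simp add: E_def h_def degree_bernstein_sum)
    show "degree (O' r a) \<le> (n - 1) div 2" for r a by (simp add: O'_def h'_def degree_bernstein_sum)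
    show "P a b =
      (if odd n then [:0, 1:] * (\<Sum>r<N. O' r a * O' r b) + [:1, -1:] * (\<Sum>r<N. E r a * E r b)
       else if n = 0 then (\<Sum>r<N. E r a * E r b)
       else (\<Sum>r<N. E r a * E r b) + ([:0, 1:] * [:1, -1:]) * (\<Sum>r<N. O' r a * O' r b))" for a b
    proof (rule poly_eqI_off_finite[OF inf])
      fix t :: real assume t: "t \<in> {0<..<1}"
      define u where "u = 1 - t"
      have u: "u \<noteq> 0" using t by (simp add: u_def)
      define SE where "SE = (\<Sum>r<N. poly (E r a) t * poly (E r b) t)"
      define SO where "SO = (\<Sum>r<N. poly (O' r a) t * poly (O' r b) t)"
      have P: "poly (P a b) t = u ^ n * (SE / (u ^ h * u ^ h) + (t / u) * (SO / (u ^ h' * u ^ h')))"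
        unfolding main[OF t] SE_def SO_def u_def by (simp add: sum_divide_distrib)
      have SE: "poly (\<Sum>r<N. E r a * E r b) t = SE" and SO: "poly (\<Sum>r<N. O' r a * O' r b) t = SO"
        by (simp_all add: SE_def SO_def poly_sum)
      consider (odd) "odd n" "n = 2 * h + 1" "h' = h" | (zero) "n = 0"
        | (even) "even n" "n = 2 * h" "h = Suc h'" "n \<noteq> 0"
      proof (cases "odd n")
        case True
        then obtain m where "n = 2 * m + 1" by (rule oddE)
        hence "n = 2 * h + 1" "h' = h" by (simp_all add: h_def h'_def)
        with True show ?thesis by (rule that(1))
      next
        case False
        hence n: "n = 2 * h" by (simp add: h_def)
        show ?thesis
        proof (cases h)
          case 0
          with n have "n = 0" by simp
          thus ?thesis by (rule that(2))
        next
          case (Suc m)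
          hence "h = Suc h'" "n \<noteq> 0" using n by (simp_all add: h'_def)
          with n False show ?thesis by (intro that(3)) simp_all
        qed
      qed
      thus "poly (P a b) t = poly (if odd n then [:0, 1:] * (\<Sum>r<N. O' r a * O' r b) + [:1, -1:] * (\<Sum>r<N. E r a * E r b)
       else if n = 0 then (\<Sum>r<N. E r a * E r b)
       else (\<Sum>r<N. E r a * E r b) + ([:0, 1:] * [:1, -1:]) * (\<Sum>r<N. O' r a * O' r b)) t"
      proof cases
        case odd
        define x where "x = u ^ h * u ^ h"
        have x: "x \<noteq> 0" using u by (simp add: x_def)
        have "u ^ n = u * x" unfolding odd(2) x_def by (simp add: mult_2 power_add)
        hence "poly (P a b) t = u * x * (SE / x + (t / u) * (SO / x))"
          using P odd(3) by (simp add: x_def)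
        also have "\<dots> = t * SO + u * SE" using u x by (simp add: field_simps)
        finally show ?thesis using odd(1) by (simp add: SE SO u_def algebra_simps)
      next
        case zero
        have "O' r a = 0" if "r < N" for r
          using degg[OF that, of a] zero by (simp add: O'_def h'_def bernstein_sum_def coeff_eq_0)
        hence "SO = 0" by (simp add: SO_def)
        thus ?thesis using P zero by (simp add: SE h_def)
      next
        case even
        define x where "x = u ^ h' * u ^ h'"
        have x: "x \<noteq> 0" using u by (simp add: x_def)
        have *: "u ^ n = u * u * x" "u ^ h * u ^ h = u * u * x"
          unfolding even(2) even(3) x_def by (simp_all add: mult_2 power_add)
        have "poly (P a b) t = u * u * x * (SE / (u * u * x) + (t / u) * (SO / x))"
          using P unfolding * by (simp add: x_def)
        also have "\<dots> = SE + t * u * SO" using u x by (simp add: field_simps)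
        finally show ?thesis using even(1,4) by (simp add: SE SO u_def algebra_simps)
      qed
    qed
  qed
qed

section \<open>Gram matrices\<close>

text \<open>The matrix of coefficients of \<open>\<Sum>\<^sub>r (\<Sum>\<^sub>i y\<^sub>i E\<^sub>r\<^sub>i(t))\<^sup>2\<close> in the monomials \<open>y\<^sub>i t\<^sup>k\<close>.\<close>

definition gram :: "nat \<Rightarrow> (nat \<Rightarrow> 'a \<Rightarrow> real poly) \<Rightarrow> 'a \<times> nat \<Rightarrow> 'a \<times> nat \<Rightarrow> real" where
  "gram N E x z = (\<Sum>r<N. coeff (E r (fst x)) (snd x) * coeff (E r (fst z)) (snd z))"

lemma psd_on_gram: "psd_on I (gram N E)"
  unfolding psd_on_iff_qform
proof (intro conjI ballI allI)
  fix y
  have "qform I (gram N E) y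
      = (\<Sum>a\<in>I. \<Sum>b\<in>I. \<Sum>r<N. (y a * coeff (E r (fst a)) (snd a)) * (y b * coeff (E r (fst b)) (snd b)))"
    by (simp add: qform_def gram_def sum_distrib_left sum_distrib_right mult_ac)
  also have "\<dots> = (\<Sum>r<N. (\<Sum>a\<in>I. y a * coeff (E r (fst a)) (snd a))\<^sup>2)"
    unfolding power2_eq_square sum_product by (rule sum_rotate[symmetric])
  also have "0 \<le> \<dots>" by (simp add: sum_nonneg)
  finally show "0 \<le> qform I (gram N E) y" .
qed (simp add: gram_def mult.commute)

lemma Lambda_gram:
  assumes "\<And>r a. r < N \<Longrightarrow> degree (E r a) \<le> e div 2"
  shows "Lambda e (gram N E) $ a $ b = (\<Sum>r<N. E r a * E r b)"
proof -
  have "(\<Sum>r<N. E r a * E r b)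
     = (\<Sum>r<N. (\<Sum>k\<le>e div 2. monom (coeff (E r a) k) k) * (\<Sum>l\<le>e div 2. monom (coeff (E r b) l) l))"
    using assms by (simp add: poly_as_sum_of_monoms')
  also have "\<dots> = (\<Sum>r<N. \<Sum>k\<le>e div 2. \<Sum>l\<le>e div 2. monom (coeff (E r a) k * coeff (E r b) l) (k + l))"
    by (simp add: sum_product mult_monom)
  also have "\<dots> = (\<Sum>k\<le>e div 2. \<Sum>l\<le>e div 2. \<Sum>r<N. monom (coeff (E r a) k * coeff (E r b) l) (k + l))"
    by (rule sum_rotate)
  also have "\<dots> = Lambda e (gram N E) $ a $ b"
    by (simp add: Lambda_def gram_def monom_sum)
  finally show ?thesis ..
qed

text \<open>The squares of the interval decomposition have the degrees that \<open>alpha\<close> and \<open>beta\<close> allow, so their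
Gram matrices serve as \<open>Q1\<close> and \<open>Q2\<close>. In the odd case the even parts carry the weight \<open>1 - t\<close> and thus
belong to \<open>beta\<close>, whereas in the even case they carry no weight and belong to \<open>alpha\<close>.\<close>

theorem interval_certificate_exists:
  fixes M :: "real poly ^ 'm ^ 'm"
  assumes psd: "\<And>t. t \<in> {0..1} \<Longrightarrow> psd (pmat_eval M t)"
    and deg: "\<And>i j. degree (M $ i $ j) \<le> e"
  obtains Q1 Q2 where "psd_on (alpha_idx e) Q1" "psd_on (beta_idx e) Q2" "M = alpha e Q1 + beta e Q2"
proof -
  have psd': "psd_on UNIV (\<lambda>a b. poly (M $ a $ b) t)" if "t \<in> {0..1}" for t
    using psd[OF that] by (simp add: psd_def pmat_eval_def)
  obtain N :: nat and E O' where E: "\<And>r a. r < N \<Longrightarrow> degree (E r a) \<le> e div 2"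
    and O': "\<And>r a. r < N \<Longrightarrow> degree (O' r a) \<le> (e - 1) div 2"
    and M: "\<And>a b. M $ a $ b =
      (if odd e then [:0, 1:] * (\<Sum>r<N. O' r a * O' r b) + [:1, -1:] * (\<Sum>r<N. E r a * E r b)
       else if e = 0 then (\<Sum>r<N. E r a * E r b)
       else (\<Sum>r<N. E r a * E r b) + ([:0, 1:] * [:1, -1:]) * (\<Sum>r<N. O' r a * O' r b))"
    by (rule interval_sos[of "\<lambda>a b. M $ a $ b" e, OF psd' deg], assumption, rule that)
  show ?thesis
  proof (cases "odd e")
    case True
    hence "(e - 1) div 2 = e div 2" by (auto elim!: oddE)
    hence "M = alpha e (gram N O') + beta e (gram N E)"
      using True E O' by (simp add: vec_eq_iff M alpha_def beta_def pmult_def Lambda_gram)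
    thus ?thesis using that psd_on_gram by blast
  next
    case False
    hence "(e - 1) div 2 = (e - 2) div 2" by presburger
    hence "M = alpha e (gram N E) + beta e (gram N O')"
      using False E O' by (simp add: vec_eq_iff M alpha_def beta_def pmult_def Lambda_gram)
    thus ?thesis using that psd_on_gram by blast
  qed
qed

lemma psd_on_add: "psd_on I M \<Longrightarrow> psd_on I M' \<Longrightarrow> psd_on I (\<lambda>a b. M a b + M' a b)"
  by (auto simp: psd_on_iff_qform qform_def distrib_left distrib_right sum.distrib intro!: add_nonneg_nonneg)

lemma psd_on_scale:
  assumes "psd_on I M" "c \<ge> 0"
  shows "psd_on I (\<lambda>a b. c * M a b)"
proof -
  have "qform I (\<lambda>a b. c * M a b) y = c * qform I M y" for y
    by (simp add: qform_def sum_distrib_left mult_ac)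
  thus ?thesis using assms by (auto simp: psd_on_iff_qform)
qed

text \<open>The form of \<open>Lambda e Q\<close> at \<open>t\<close> is the form of \<open>Q\<close> on the vector of monomials \<open>y\<^sub>i t\<^sup>k\<close>.\<close>

lemma psd_on_Lambda:
  fixes Q :: "'m::finite \<times> nat \<Rightarrow> 'm \<times> nat \<Rightarrow> real"
  assumes "psd_on (UNIV \<times> {..e div 2}) Q"
  shows "psd_on UNIV (\<lambda>i j. poly (Lambda e Q $ i $ j) t)"
  unfolding psd_on_iff_qform
proof (intro conjI ballI allI)
  have Q: "Q (i, k) (j, l) = Q (j, l) (i, k)" if "k \<le> e div 2" "l \<le> e div 2" for i j k l
    using assms that by (auto simp: psd_on_def)
  fix i j
  have "Lambda e Q $ i $ j = (\<Sum>l\<le>e div 2. \<Sum>k\<le>e div 2. monom (Q (i, k) (j, l)) (k + l))"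
    by (simp add: Lambda_def) (rule sum.swap)
  also have "\<dots> = Lambda e Q $ j $ i"
    by (simp add: Lambda_def Q add.commute)
  finally show "poly (Lambda e Q $ i $ j) t = poly (Lambda e Q $ j $ i) t" by simp
next
  have pair: "(\<Sum>x\<in>UNIV \<times> {..e div 2}. f x) = (\<Sum>i\<in>UNIV. \<Sum>k\<le>e div 2. f (i, k))"
    for f :: "'m \<times> nat \<Rightarrow> real"
    by (simp add: sum.cartesian_product split_def)
  fix y
  have "qform UNIV (\<lambda>i j. poly (Lambda e Q $ i $ j) t) y
     = (\<Sum>i\<in>UNIV. \<Sum>j\<in>UNIV. \<Sum>k\<le>e div 2. \<Sum>l\<le>e div 2. (y i * t ^ k) * Q (i, k) (j, l) * (y j * t ^ l))"
    by (simp add: qform_def Lambda_def poly_sum poly_monom sum_distrib_left sum_distrib_right power_add mult_ac)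
  also have "\<dots> = (\<Sum>i\<in>UNIV. \<Sum>k\<le>e div 2. \<Sum>j\<in>UNIV. \<Sum>l\<le>e div 2. (y i * t ^ k) * Q (i, k) (j, l) * (y j * t ^ l))"
    by (rule sum.cong[OF refl], rule sum.swap)
  also have "\<dots> = qform (UNIV \<times> {..e div 2}) Q (\<lambda>(i, k). y i * t ^ k)"
    unfolding qform_def pair by simp
  also have "0 \<le> \<dots>" using assms by (simp add: psd_on_iff_qform)
  finally show "0 \<le> qform UNIV (\<lambda>i j. poly (Lambda e Q $ i $ j) t) y" .
qed

lemma psd_certificate:
  fixes Q1 Q2 :: "'m::finite \<times> nat \<Rightarrow> 'm \<times> nat \<Rightarrow> real"
  assumes "psd_on (alpha_idx e) Q1" "psd_on (beta_idx e) Q2" "t \<in> {0..1}"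
  shows "psd (pmat_eval (alpha e Q1 + beta e Q2) t)"
proof -
  have "psd_on UNIV (\<lambda>i j. poly (alpha e Q1 $ i $ j) t)"
  proof (cases "odd e")
    case True
    hence "{..<(e + 1) div 2} = {..(e - 1) div 2}" by (auto elim!: oddE)
    hence "psd_on UNIV (\<lambda>i j. poly (Lambda (e - 1) Q1 $ i $ j) t)"
      using assms(1) True by (intro psd_on_Lambda) (simp add: alpha_idx_def)
    from psd_on_scale[OF this, of t] assms(3) True show ?thesis
      by (simp add: alpha_def pmult_def)
  next
    case False
    hence "{..<e div 2 + 1} = {..e div 2}" by auto
    hence "psd_on UNIV (\<lambda>i j. poly (Lambda e Q1 $ i $ j) t)"
      using assms(1) False by (intro psd_on_Lambda) (simp add: alpha_idx_def)
    thus ?thesis using False by (simp add: alpha_def)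
  qed
  moreover have "psd_on UNIV (\<lambda>i j. poly (beta e Q2 $ i $ j) t)"
  proof -
    consider "odd e" | "e = 0" | "even e" "e \<noteq> 0" by blast
    thus ?thesis
    proof cases
      case 1
      hence "{..<(e + 1) div 2} = {..(e - 1) div 2}" by (auto elim!: oddE)
      hence "psd_on UNIV (\<lambda>i j. poly (Lambda (e - 1) Q2 $ i $ j) t)"
        using assms(2) 1 by (intro psd_on_Lambda) (simp add: beta_idx_def)
      from psd_on_scale[OF this, of "1 - t"] assms(3) 1 show ?thesis
        by (simp add: beta_def pmult_def algebra_simps)
    next
      case 2
      thus ?thesis by (simp add: beta_def psd_on_def)
    next
      case 3
      hence "{..<e div 2} = {..(e - 2) div 2}" by (auto elim!: evenE)
      hence "psd_on UNIV (\<lambda>i j. poly (Lambda (e - 2) Q2 $ i $ j) t)"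
        using assms(2) 3 by (intro psd_on_Lambda) (simp add: beta_idx_def)
      moreover have "0 \<le> t * (1 - t)" using assms(3) by simp
      ultimately have "psd_on UNIV (\<lambda>i j. t * (1 - t) * poly (Lambda (e - 2) Q2 $ i $ j) t)"
        by (rule psd_on_scale)
      thus ?thesis using 3 by (simp add: beta_def pmult_def algebra_simps)
    qed
  qed
  ultimately have "psd_on UNIV (\<lambda>i j. poly (alpha e Q1 $ i $ j) t + poly (beta e Q2 $ i $ j) t)"
    by (rule psd_on_add)
  thus ?thesis by (simp add: psd_def pmat_eval_def)
qed

section \<open>The constraint operator on polynomial arguments\<close>

text \<open>A strict inequality \<open>f t0 < 0\<close> would persist on a nonempty open interval, which is not a null set.\<close>

lemma continuous_AE_nonneg_imp_nonneg:
  fixes f :: "real \<Rightarrow> real"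
  assumes cont: "continuous_on {0..1} f" and AE: "AE t in lebesgue_on {0..1}. 0 \<le> f t"
    and t0: "t0 \<in> {0..1}"
  shows "0 \<le> f t0"
proof (rule ccontr)
  assume "\<not> 0 \<le> f t0"
  then obtain \<delta> where \<delta>: "\<delta> > 0" "\<And>t. t \<in> {0..1} \<Longrightarrow> dist t t0 < \<delta> \<Longrightarrow> dist (f t) (f t0) < - f t0"
    using cont t0 unfolding continuous_on_iff by (metis neg_0_less_iff_less not_le)
  define U where "U = {max 0 (t0 - \<delta>) <..< min 1 (t0 + \<delta>)}"
  have neg: "t \<in> {0..1} \<and> \<not> 0 \<le> f t" if "t \<in> U" for t
    using \<delta>(2)[of t] that by (auto simp: U_def dist_real_def abs_less_iff)
  have "AE t in lebesgue. t \<in> {0..1} \<longrightarrow> 0 \<le> f t"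
    using AE by (subst (asm) AE_restrict_space_iff) auto
  then obtain Z where "negligible Z" "{t. \<not> (t \<in> {0..1} \<longrightarrow> 0 \<le> f t)} \<subseteq> Z"
    unfolding eventually_ae_filter negligible_iff_null_sets by auto
  moreover have "U \<subseteq> {t. \<not> (t \<in> {0..1} \<longrightarrow> 0 \<le> f t)}" using neg by blast
  ultimately have "negligible U" by (meson negligible_subset order_trans)
  moreover have "open U" "U \<noteq> {}"
    using t0 \<delta>(1) by (auto simp: U_def)
  ultimately show False using open_not_negligible by blast
qed

definition poly_integral :: "real poly \<Rightarrow> real poly" where
  "poly_integral p = (\<Sum>k\<le>degree p. monom (coeff p k / real (k + 1)) (k + 1))"

lemma degree_poly_integral: "degree (poly_integral p) \<le> degree p + 1"
  unfolding poly_integral_def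
  by (rule degree_sum_le) (auto intro: le_trans[OF degree_monom_le])

lemma pderiv_poly_integral: "pderiv (poly_integral p) = p"
proof -
  have "pderiv (poly_integral p) = (\<Sum>k\<le>degree p. pderiv (monom (coeff p k / real (k + 1)) (k + 1)))"
    unfolding poly_integral_def using higher_pderiv_sum[where n = 1] by simp
  also have "\<dots> = (\<Sum>k\<le>degree p. monom (coeff p k) k)"
    by (intro sum.cong refl) (simp add: pderiv_monom)
  also have "\<dots> = p" by (rule poly_as_sum_of_monoms)
  finally show ?thesis .
qed

lemma poly_integral_0: "poly (poly_integral p) 0 = 0"
  by (simp add: poly_integral_def poly_sum poly_monom)

text \<open>\<open>\<integral>\<^sub>0\<^sup>t p(s) E(t,s) ds\<close> as a polynomial in \<open>t\<close>, integrated monomial by monomial in \<open>s\<close>.\<close>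

definition volterra :: "real poly \<Rightarrow> real poly poly \<Rightarrow> real poly" where
  "volterra p E = (\<Sum>k\<le>degree E. coeff E k * poly_integral (p * monom 1 k))"

lemma has_integral_poly_integral:
  "0 \<le> t \<Longrightarrow> ((\<lambda>s. poly p s) has_integral poly (poly_integral p) t) {0..t}"
  using fundamental_theorem_of_calculus[of 0 t "poly (poly_integral p)" "poly p"]
    poly_DERIV[of "poly_integral p"]
  by (simp add: poly_integral_0 pderiv_poly_integral has_real_derivative_iff_has_vector_derivative[symmetric]
      has_field_derivative_at_within)

lemma poly2_eq_sum: "poly2 E t s = (\<Sum>k\<le>degree E. poly (coeff E k) t * s ^ k)"
  by (simp add: poly2_def poly_altdef[of E] poly_sum)

lemma has_integral_volterra:
  assumes "0 \<le> t"
  shows "((\<lambda>s. poly p s * poly2 E t s) has_integral poly (volterra p E) t) {0..t}"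
proof -
  have "((\<lambda>s. \<Sum>k\<le>degree E. poly (coeff E k) t * poly (p * monom 1 k) s) has_integral
     (\<Sum>k\<le>degree E. poly (coeff E k) t * poly (poly_integral (p * monom 1 k)) t)) {0..t}"
    by (intro has_integral_sum has_integral_mult_right has_integral_poly_integral assms) simp
  thus ?thesis
    by (simp add: volterra_def poly_sum poly2_eq_sum poly_monom sum_distrib_left mult_ac)
qed

lemma degree_volterra:
  assumes "degree p \<le> d"
  shows "degree (volterra p E) \<le> total_degree E + d + 1"
  unfolding volterra_def
proof (rule degree_sum_le)
  fix k assume "k \<in> {..degree E}"
  hence "k + degree (coeff E k) \<le> total_degree E"
    unfolding total_degree_def by (intro Max_ge) auto
  moreover have "degree (p * monom 1 k) \<le> d + k"
    using degree_mult_le[of p "monom 1 k"] degree_monom_le[of "1::real" k] assms by linarith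
  ultimately show "degree (coeff E k * poly_integral (p * monom 1 k)) \<le> total_degree E + d + 1"
    using degree_mult_le[of "coeff E k" "poly_integral (p * monom 1 k)"]
      degree_poly_integral[of "p * monom 1 k"] by linarith
qed simp

lemma volterra_0 [simp]: "volterra p 0 = 0"
  by (simp add: volterra_def)

definition F_poly ::
  "real poly ^ 'm ^ 'm \<Rightarrow> ('n \<Rightarrow> real poly ^ 'm ^ 'm) \<Rightarrow> ('n \<Rightarrow> real poly poly ^ 'm ^ 'm)
    \<Rightarrow> real poly ^ 'n \<Rightarrow> real poly ^ 'm ^ 'm" where
  "F_poly A0 A D p = (\<chi> i j. A0 $ i $ j + (\<Sum>l\<in>UNIV. p $ l * A l $ i $ j)
     + (\<Sum>l\<in>UNIV. volterra (p $ l) (D l $ i $ j)))"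

text \<open>The matrix-valued integral is computed entry by entry, which is legitimate because its integrand is
continuous and hence integrable.\<close>

lemma LINT_volterra_component:
  fixes E :: "real poly poly ^ 'm ^ 'm"
  assumes "0 \<le> t"
  shows "(LINT s:{0..t}|lebesgue. poly q s *\<^sub>R pmat_eval2 E t s) $ i $ j
    = poly (volterra q (E $ i $ j)) t"
proof -
  let ?G = "\<lambda>s. poly q s *\<^sub>R pmat_eval2 E t s"
  have "continuous_on {0..t} ?G"
    unfolding pmat_eval2_def poly2_eq_sum
    by (intro continuous_intros continuous_on_vec_lambda)
  hence G: "set_integrable lebesgue {0..t} ?G"
    by (rule absolutely_integrable_continuous_real)
  note int = set_lebesgue_integral_eq_integral[OF G]
  have int_i: "(\<lambda>s. ?G s $ i) integrable_on {0..t}" "integral {0..t} (\<lambda>s. ?G s $ i) = integral {0..t} ?G $ i"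
    using integrable_linear[OF int(1) bounded_linear_vec_nth[of i]]
      integral_linear[OF int(1) bounded_linear_vec_nth[of i]] by (simp_all add: o_def)
  have "(LINT s:{0..t}|lebesgue. ?G s) $ i $ j = integral {0..t} (\<lambda>s. ?G s $ i $ j)"
    unfolding int(2) int_i(2)[symmetric] by (rule integral_component_eq_cart[OF int_i(1), symmetric])
  also have "\<dots> = poly (volterra q (E $ i $ j)) t"
    using has_integral_volterra[OF assms, of q "E $ i $ j"]
    by (intro integral_unique) (simp add: pmat_eval2_def)
  finally show ?thesis .
qed

lemma F_op_pvec_eval:
  assumes "0 \<le> t"
  shows "F_op A0 A D (pvec_eval p) t = pmat_eval (F_poly A0 A D p) t"
  by (simp add: vec_eq_iff F_op_def F_poly_def pmat_eval_def pvec_eval_def poly_sum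
      LINT_volterra_component[OF assms])

lemma F_poly_symmetric:
  fixes A0 :: "real poly ^ 'm ^ 'm"
  assumes "transpose A0 = A0" "\<And>i. transpose (A i) = A i" "\<And>i. transpose (D i) = D i"
  shows "F_poly A0 A D p $ i $ j = F_poly A0 A D p $ j $ i"
proof -
  have transpose_nth: "M $ i $ j = M $ j $ i" if "transpose M = M" for M :: "'c::zero poly ^ 'm ^ 'm"
    using arg_cong[OF that, of "\<lambda>M. M $ j $ i"] by (simp add: transpose_def)
  show ?thesis
    by (simp add: F_poly_def transpose_nth[OF assms(1)] transpose_nth[OF assms(2)]
        transpose_nth[OF assms(3)])
qed

lemma degree_le_pmat_degree: "degree (M $ i $ j) \<le> pmat_degree M"
proof -
  have "{degree (M $ i $ j) | i j. True} = (\<lambda>(i, j). degree (M $ i $ j)) ` UNIV" by auto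
  thus ?thesis unfolding pmat_degree_def by (intro Max_ge) auto
qed

lemma total_degree_le_pmat_total_degree: "total_degree (M $ i $ j) \<le> pmat_total_degree M"
proof -
  have "{total_degree (M $ i $ j) | i j. True} = (\<lambda>(i, j). total_degree (M $ i $ j)) ` UNIV" by auto
  thus ?thesis unfolding pmat_total_degree_def by (intro Max_ge) auto
qed

lemma sdp_degree_ge:
  shows "A0 \<noteq> 0 \<Longrightarrow> pmat_degree A0 \<le> sdp_degree A0 A D d"
    and "A l \<noteq> 0 \<Longrightarrow> pmat_degree (A l) + d \<le> sdp_degree A0 A D d"
    and "D l \<noteq> 0 \<Longrightarrow> pmat_total_degree (D l) + d + 1 \<le> sdp_degree A0 A D d"
proof -
  have "{pmat_degree (A i) + d | i. A i \<noteq> 0} \<subseteq> range (\<lambda>i. pmat_degree (A i) + d)"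
    "{pmat_total_degree (D i) + d + 1 | i. D i \<noteq> 0} \<subseteq> range (\<lambda>i. pmat_total_degree (D i) + d + 1)"
    by auto
  hence fin: "finite {pmat_degree (A i) + d | i. A i \<noteq> 0}"
    "finite {pmat_total_degree (D i) + d + 1 | i. D i \<noteq> 0}"
    by (auto elim!: finite_subset)
  show "A0 \<noteq> 0 \<Longrightarrow> pmat_degree A0 \<le> sdp_degree A0 A D d"
    unfolding sdp_degree_def by (rule Max_ge) (use fin in auto)
  show "A l \<noteq> 0 \<Longrightarrow> pmat_degree (A l) + d \<le> sdp_degree A0 A D d"
    unfolding sdp_degree_def by (rule Max_ge) (use fin in auto)
  show "D l \<noteq> 0 \<Longrightarrow> pmat_total_degree (D l) + d + 1 \<le> sdp_degree A0 A D d"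
    unfolding sdp_degree_def by (rule Max_ge) (use fin in auto)
qed

text \<open>This is where the value of \<open>sdp_degree\<close> comes from: multiplying by \<open>p\<close> costs \<open>d\<close> degrees, integrating
one more.\<close>

lemma degree_F_poly:
  assumes "p \<in> poly_vecs d"
  shows "degree (F_poly A0 A D p $ i $ j) \<le> sdp_degree A0 A D d"
proof -
  have p: "degree (p $ l) \<le> d" for l using assms by (simp add: poly_vecs_def)
  have "degree (A0 $ i $ j) \<le> sdp_degree A0 A D d"
    using degree_le_pmat_degree[of A0 i j] sdp_degree_ge(1)[of A0 A D d] by (cases "A0 = 0") auto
  moreover have "degree (p $ l * A l $ i $ j) \<le> sdp_degree A0 A D d" for l
    using degree_mult_le[of "p $ l" "A l $ i $ j"] p[of l] degree_le_pmat_degree[of "A l" i j]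
      sdp_degree_ge(2)[of A l d A0 D] by (cases "A l = 0") auto
  moreover have "degree (volterra (p $ l) (D l $ i $ j)) \<le> sdp_degree A0 A D d" for l
    using degree_volterra[OF p[of l], of "D l $ i $ j"] total_degree_le_pmat_total_degree[of "D l" i j]
      sdp_degree_ge(3)[of D l d A0 A] by (cases "D l = 0") auto
  ultimately show ?thesis
    by (simp add: F_poly_def degree_add_le degree_sum_le)
qed

lemma pvec_eval_in_L_space: "pvec_eval p \<in> L_space"
proof -
  have cont: "continuous_on {0..1} (pvec_eval p)"
    unfolding pvec_eval_def by (intro continuous_on_vec_lambda continuous_intros)
  hence "bounded (pvec_eval p ` {0..1})"
    by (intro compact_imp_bounded compact_continuous_image) auto
  then obtain B where "\<forall>x\<in>pvec_eval p ` {0..1}. norm x \<le> B"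
    unfolding bounded_iff by blast
  hence B: "norm (pvec_eval p t) \<le> B" if "t \<in> {0..1}" for t
    using that by blast
  have "\<bar>pvec_eval p t $ i\<bar> \<le> B" if "t \<in> {0..1}" for t i
    using component_le_norm_cart[of "pvec_eval p t" i] B[OF that] by linarith
  hence "bdd_above {\<bar>pvec_eval p t $ i\<bar> | t i. t \<in> {0..1}}"
    by (intro bdd_aboveI[of _ B]) blast
  thus ?thesis
    using continuous_imp_measurable_on_sets_lebesgue[OF cont] by (simp add: L_space_def)
qed

text \<open>For polynomial arguments the quadratic form is continuous in \<open>t\<close>, so the constraint for almost every
\<open>t\<close> is the constraint for every \<open>t\<close>.\<close>

lemma tv_feasible_pvec_eval_iff:
  fixes A0 :: "real poly ^ 'm ^ 'm"
  assumes sym: "transpose A0 = A0" "\<And>i. transpose (A i) = A i" "\<And>i. transpose (D i) = D i"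
  shows "tv_feasible A0 A D (pvec_eval p) \<longleftrightarrow> (\<forall>t\<in>{0..1}. psd (pmat_eval (F_poly A0 A D p) t))"
proof
  let ?M = "F_poly A0 A D p"
  assume "tv_feasible A0 A D (pvec_eval p)"
  hence AE: "AE t in lebesgue_on {0..1}. psd (F_op A0 A D (pvec_eval p) t)"
    by (simp add: tv_feasible_def)
  show "\<forall>t\<in>{0..1}. psd (pmat_eval ?M t)"
  proof
    fix t :: real assume t: "t \<in> {0..1}"
    have "0 \<le> qform UNIV (\<lambda>a b. poly (?M $ a $ b) t) y" for y
    proof (rule continuous_AE_nonneg_imp_nonneg[OF _ _ t])
      show "continuous_on {0..1} (\<lambda>t. qform UNIV (\<lambda>a b. poly (?M $ a $ b) t) y)"
        by (intro continuous_at_imp_continuous_on ballI continuous_qform_poly)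
      show "AE t in lebesgue_on {0..1}. 0 \<le> qform UNIV (\<lambda>a b. poly (?M $ a $ b) t) y"
        using AE AE_space
      proof eventually_elim
        case (elim t)
        thus ?case by (simp add: F_op_pvec_eval psd_def psd_on_iff_qform pmat_eval_def qform_def)
      qed
    qed
    thus "psd (pmat_eval ?M t)"
      using F_poly_symmetric[of A0 A D p, OF sym]
      unfolding psd_def psd_on_iff_qform by (auto simp: pmat_eval_def qform_def)
  qed
next
  assume "\<forall>t\<in>{0..1}. psd (pmat_eval (F_poly A0 A D p) t)"
  hence "AE t in lebesgue_on {0..1}. psd (F_op A0 A D (pvec_eval p) t)"
    by (intro AE_I2) (simp add: F_op_pvec_eval space_lebesgue_on)
  thus "tv_feasible A0 A D (pvec_eval p)"
    by (simp add: tv_feasible_def pvec_eval_in_L_space)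
qed

section \<open>Exactness of the semidefinite program\<close>

theorem theorem6:
  fixes c :: "real poly ^ 'n"
    and A0 :: "real poly ^ 'm ^ 'm"
    and A :: "'n \<Rightarrow> real poly ^ 'm ^ 'm"
    and D :: "'n \<Rightarrow> real poly poly ^ 'm ^ 'm"
    and d :: nat
  assumes "transpose A0 = A0"
    and "\<And>i. transpose (A i) = A i"
    and "\<And>i. transpose (D i) = D i"
  shows "(\<forall>p \<in> poly_vecs d.
            tv_feasible A0 A D (pvec_eval p) \<longleftrightarrow> (\<exists>Q1 Q2. sdp_feasible A0 A D d p Q1 Q2))
       \<and> Sup {ereal (objective c (pvec_eval p)) | p Q1 Q2. sdp_feasible A0 A D d p Q1 Q2}
         = Sup {ereal (objective c (pvec_eval p)) | p.
                  p \<in> poly_vecs d \<and> tv_feasible A0 A D (pvec_eval p)}"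
proof -
  have certificate: "sdp_feasible A0 A D d p Q1 Q2 \<longleftrightarrow>
      psd_on (alpha_idx (sdp_degree A0 A D d)) Q1 \<and> psd_on (beta_idx (sdp_degree A0 A D d)) Q2 \<and>
      (\<forall>t\<in>{0..1}. pmat_eval (F_poly A0 A D p) t
         = pmat_eval (alpha (sdp_degree A0 A D d) Q1 + beta (sdp_degree A0 A D d) Q2) t)"
    if "p \<in> poly_vecs d" for p Q1 Q2
    using that by (simp add: sdp_feasible_def Let_def F_op_pvec_eval)
  have equiv: "tv_feasible A0 A D (pvec_eval p) \<longleftrightarrow> (\<exists>Q1 Q2. sdp_feasible A0 A D d p Q1 Q2)"
    if p: "p \<in> poly_vecs d" for p
  proof
    assume "tv_feasible A0 A D (pvec_eval p)"
    hence "psd (pmat_eval (F_poly A0 A D p) t)" if "t \<in> {0..1}" for t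
      using tv_feasible_pvec_eval_iff[of A0 A D, OF assms] that by blast
    then obtain Q1 Q2 where "psd_on (alpha_idx (sdp_degree A0 A D d)) Q1"
      "psd_on (beta_idx (sdp_degree A0 A D d)) Q2"
      "F_poly A0 A D p = alpha (sdp_degree A0 A D d) Q1 + beta (sdp_degree A0 A D d) Q2"
      by (rule interval_certificate_exists[OF _ degree_F_poly[OF p]])
    thus "\<exists>Q1 Q2. sdp_feasible A0 A D d p Q1 Q2"
      unfolding certificate[OF p] by auto
  next
    assume "\<exists>Q1 Q2. sdp_feasible A0 A D d p Q1 Q2"
    then obtain Q1 Q2 where "sdp_feasible A0 A D d p Q1 Q2" by blast
    hence "psd (pmat_eval (F_poly A0 A D p) t)" if "t \<in> {0..1}" for t
      using psd_certificate that unfolding certificate[OF p] by metis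
    thus "tv_feasible A0 A D (pvec_eval p)"
      using tv_feasible_pvec_eval_iff[of A0 A D, OF assms] by blast
  qed
  have "p \<in> poly_vecs d" if "sdp_feasible A0 A D d p Q1 Q2" for p Q1 Q2
    using that by (simp add: sdp_feasible_def Let_def)
  with equiv have "{ereal (objective c (pvec_eval p)) | p Q1 Q2. sdp_feasible A0 A D d p Q1 Q2}
      = {ereal (objective c (pvec_eval p)) | p. p \<in> poly_vecs d \<and> tv_feasible A0 A D (pvec_eval p)}"
    by blast
  with equiv show ?thesis by simp
qed

end
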